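(* Let $\mathbb K=\mathbb R$ or $\mathbb C$. The map-germ $C_3\colon(\mathbb K^2,0)\to(\mathbb K^3,0)$ given by $C_3(x,y)=(x,y^2,xy^3+x^3y)$ is not an augmentation.
   Context: "Smooth" means $C^\infty$ if $\mathbb K=\mathbb R$ and holomorphic if $\mathbb K=\mathbb C$. $\mathscr A$-equivalence of map-germs is equivalence under germs of diffeomorphisms in source and target. A smooth germ $f\colon(\mathbb K^n,0)\to(\mathbb K^p,0)$ is stable if $\theta(f)=df(\theta_n)+\{\eta\circ f:\eta\in\theta_p\}$, where $\theta(f)$ is the module of vector fields along $f$ and $\theta_s$ the module of germs at $0$ of smooth vector fields on $\mathbb K^s$. A 1-parameter stable unfolding (OPSU) of $f$ is a stable map-germ $F\colon(\mathbb K^n\times\mathbb K,0)\to(\mathbb K^p\times\mathbb K,0)$ of the form $F(x,\lambda)=(f_\lambda(x),\lambda)$ with $f_0=f$. The augmentation of $f$ by $F$ via a smooth function $g\colon(\mathbb K^d,0)\to(\mathbb K,0)$ is the $\mathscr A$-class of the germ $A_{F,g}(f)(x,z)=(f_{g(z)}(x),z)$ from $(\mathbb K^n\times\mathbb K^d,0)$ to $(\mathbb K^p\times\mathbb K^d,0)$. A map-germ is an augmentation if it is $\mathscr A$-equivalent to $A_{F,g}(f)$ for some $f$, some OPSU $F$ of $f$ and some $g$ with $d\ge1$. *)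

theory Defs
  imports "HOL-Analysis.Analysis"
begin

text \<open>
  Dimensions vary inside the notion of an augmentation (and may be 0), so \<open>K\<^sup>n\<close> is the set of
  sequences vanishing from index \<open>n\<close> on. The product topology of \<^typ>\<open>nat \<Rightarrow> 'k\<close> induces the usual
  topology on it. A germ on \<open>K\<^sup>n\<close> is given by any representative \<^typ>\<open>(nat \<Rightarrow> 'k) \<Rightarrow> 'b\<close>, of which
  only the values on \<open>K\<^sup>n\<close> near the origin matter.
\<close>

type_synonym 'k vec = "nat \<Rightarrow> 'k"

definition Kn :: "nat \<Rightarrow> ('k::zero) vec set" where
  "Kn n = {v. \<forall>i\<ge>n. v i = 0}"

abbreviation orig :: "('k::zero) vec" where
  "orig \<equiv> (\<lambda>_. 0)"

definition nbhd0 :: "nat \<Rightarrow> ('k::{zero,topological_space}) vec set \<Rightarrow> bool" where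
  "nbhd0 n U \<longleftrightarrow> openin (top_of_set (Kn n)) U \<and> orig \<in> U"

definition germ_eq ::
    "nat \<Rightarrow> (('k::{zero,topological_space}) vec \<Rightarrow> 'b) \<Rightarrow> ('k vec \<Rightarrow> 'b) \<Rightarrow> bool" where
  "germ_eq n f g \<longleftrightarrow> (\<exists>U. nbhd0 n U \<and> (\<forall>x\<in>U. f x = g x))"

text \<open>The identification \<open>K\<^sup>n \<times> K\<^sup>d = K\<^sup>n\<^sup>+\<^sup>d\<close> and its two projections.\<close>

definition pair :: "nat \<Rightarrow> 'k vec \<Rightarrow> 'k vec \<Rightarrow> 'k vec" where
  "pair n x z = (\<lambda>i. if i < n then x i else z (i - n))"

definition fstv :: "nat \<Rightarrow> ('k::zero) vec \<Rightarrow> 'k vec" where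
  "fstv n v = (\<lambda>i. if i < n then v i else 0)"

definition sndv :: "nat \<Rightarrow> 'k vec \<Rightarrow> 'k vec" where
  "sndv n v = (\<lambda>i. v (n + i))"


definition partial :: "nat \<Rightarrow> (('k::real_normed_field) vec \<Rightarrow> 'k) \<Rightarrow> 'k vec \<Rightarrow> 'k" where
  "partial i f x = deriv (\<lambda>t. f (x(i := t))) (x i)"

definition has_partials_on ::
    "nat \<Rightarrow> ('k::real_normed_field) vec set \<Rightarrow> ('k vec \<Rightarrow> 'k) \<Rightarrow> bool" where
  "has_partials_on n U f \<longleftrightarrow>
     (\<forall>x\<in>U. \<forall>i<n. (\<lambda>t. f (x(i := t))) field_differentiable at (x i))"

primrec Ck_on :: "nat \<Rightarrow> real vec set \<Rightarrow> nat \<Rightarrow> (real vec \<Rightarrow> real) \<Rightarrow> bool" where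
  "Ck_on n U 0 f \<longleftrightarrow> continuous_on U f"
| "Ck_on n U (Suc k) f \<longleftrightarrow>
     continuous_on U f \<and> has_partials_on n U f \<and> (\<forall>i<n. Ck_on n U k (partial i f))"

text \<open>
  \<open>smooth_fun_on n U f\<close>, for \<open>U\<close> open in \<open>K\<^sup>n\<close>, means \<open>C\<^sup>\<infinity>\<close> over the reals, and holomorphic
  (continuous and complex differentiable in each variable) over the complex numbers.
\<close>

class smooth_scalar = real_normed_field +
  fixes smooth_fun_on :: "nat \<Rightarrow> (nat \<Rightarrow> 'a) set \<Rightarrow> ((nat \<Rightarrow> 'a) \<Rightarrow> 'a) \<Rightarrow> bool"

instantiation real :: smooth_scalar
begin

definition smooth_fun_on_real :: "nat \<Rightarrow> real vec set \<Rightarrow> (real vec \<Rightarrow> real) \<Rightarrow> bool" where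
  "smooth_fun_on_real n U f \<longleftrightarrow> (\<forall>k. Ck_on n U k f)"

instance ..

end

instantiation complex :: smooth_scalar
begin

definition smooth_fun_on_complex ::
    "nat \<Rightarrow> complex vec set \<Rightarrow> (complex vec \<Rightarrow> complex) \<Rightarrow> bool" where
  "smooth_fun_on_complex n U f \<longleftrightarrow> continuous_on U f \<and> has_partials_on n U f"

instance ..

end

text \<open>
  Smooth germs \<open>(K\<^sup>n,0) \<rightarrow> K\<^sup>p\<close> with arbitrary value at the origin. This is also the module
  \<open>\<theta>(f)\<close> of vector fields along any \<open>f : (K\<^sup>n,0) \<rightarrow> (K\<^sup>p,0)\<close>, and for \<open>p = n\<close> it is \<open>\<theta>\<^sub>n\<close>.
\<close>

definition smooth_germ ::
    "nat \<Rightarrow> nat \<Rightarrow> (('k::smooth_scalar) vec \<Rightarrow> 'k vec) \<Rightarrow> bool" where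
  "smooth_germ n p f \<longleftrightarrow>
     (\<exists>U. nbhd0 n U \<and> f ` U \<subseteq> Kn p \<and> (\<forall>j<p. smooth_fun_on n U (\<lambda>x. f x j)))"

definition map_germ ::
    "nat \<Rightarrow> nat \<Rightarrow> (('k::smooth_scalar) vec \<Rightarrow> 'k vec) \<Rightarrow> bool" where
  "map_germ n p f \<longleftrightarrow> smooth_germ n p f \<and> f orig = orig"


definition diffeo_germ :: "nat \<Rightarrow> (('k::smooth_scalar) vec \<Rightarrow> 'k vec) \<Rightarrow> bool" where
  "diffeo_germ n \<phi> \<longleftrightarrow> map_germ n n \<phi> \<and>
     (\<exists>\<psi>. map_germ n n \<psi> \<and> germ_eq n (\<psi> \<circ> \<phi>) id \<and> germ_eq n (\<phi> \<circ> \<psi>) id)"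

definition A_equivalent ::
    "nat \<Rightarrow> nat \<Rightarrow> (('k::smooth_scalar) vec \<Rightarrow> 'k vec) \<Rightarrow> ('k vec \<Rightarrow> 'k vec) \<Rightarrow> bool" where
  "A_equivalent n p f g \<longleftrightarrow>
     (\<exists>\<phi> \<psi>. diffeo_germ n \<phi> \<and> diffeo_germ p \<psi> \<and> germ_eq n (\<psi> \<circ> f) (g \<circ> \<phi>))"

definition dmap ::
    "nat \<Rightarrow> nat \<Rightarrow> (('k::real_normed_field) vec \<Rightarrow> 'k vec) \<Rightarrow> ('k vec \<Rightarrow> 'k vec) \<Rightarrow> 'k vec \<Rightarrow> 'k vec"
  where
  "dmap n p f \<xi> x = (\<lambda>j. if j < p then \<Sum>i<n. partial i (\<lambda>y. f y j) x * \<xi> x i else 0)"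

text \<open>
  Only the inclusion \<open>\<theta>(f) \<subseteq> df(\<theta>\<^sub>n) + {\<eta> \<circ> f | \<eta> \<in> \<theta>\<^sub>p}\<close> is required; the other one always holds.
\<close>

definition stable_germ ::
    "nat \<Rightarrow> nat \<Rightarrow> (('k::smooth_scalar) vec \<Rightarrow> 'k vec) \<Rightarrow> bool" where
  "stable_germ n p f \<longleftrightarrow> map_germ n p f \<and>
     (\<forall>\<zeta>. smooth_germ n p \<zeta> \<longrightarrow>
        (\<exists>\<xi> \<eta>. smooth_germ n n \<xi> \<and> smooth_germ p p \<eta> \<and>
           germ_eq n \<zeta> (\<lambda>x j. dmap n p f \<xi> x j + \<eta> (f x) j)))"

text \<open>
  \<open>slice n p F c x\<close> is \<open>f\<^sub>c(x)\<close> where \<open>F(x,\<lambda>) = (f\<^sub>\<lambda>(x),\<lambda>)\<close>; the parameter \<open>c\<close> is an element of \<open>K\<^sup>1\<close>.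
\<close>

definition slice ::
    "nat \<Rightarrow> nat \<Rightarrow> (('k::zero) vec \<Rightarrow> 'k vec) \<Rightarrow> 'k vec \<Rightarrow> 'k vec \<Rightarrow> 'k vec" where
  "slice n p F c x = fstv p (F (pair n x c))"

definition OPSU ::
    "nat \<Rightarrow> nat \<Rightarrow> (('k::smooth_scalar) vec \<Rightarrow> 'k vec) \<Rightarrow> ('k vec \<Rightarrow> 'k vec) \<Rightarrow> bool" where
  "OPSU n p f F \<longleftrightarrow> stable_germ (n + 1) (p + 1) F \<and>
     germ_eq (n + 1) F (\<lambda>v. pair p (slice n p F (sndv n v) (fstv n v)) (sndv n v)) \<and>
     germ_eq n (slice n p F orig) f"

definition augmentation ::
    "nat \<Rightarrow> nat \<Rightarrow> (('k::zero) vec \<Rightarrow> 'k vec) \<Rightarrow> ('k vec \<Rightarrow> 'k vec) \<Rightarrow> 'k vec \<Rightarrow> 'k vec" where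
  "augmentation n p F g v = pair p (slice n p F (g (sndv n v)) (fstv n v)) (sndv n v)"

definition is_augmentation ::
    "nat \<Rightarrow> nat \<Rightarrow> (('k::smooth_scalar) vec \<Rightarrow> 'k vec) \<Rightarrow> bool" where
  "is_augmentation N P h \<longleftrightarrow>
     (\<exists>n p d f F g. N = n + d \<and> P = p + d \<and> d \<ge> 1 \<and>
        map_germ n p f \<and> OPSU n p f F \<and> map_germ d 1 g \<and>
        A_equivalent N P h (augmentation n p F g))"

definition C3 :: "('k::real_normed_field) vec \<Rightarrow> 'k vec" where
  "C3 v = (let x = v 0; y = v 1 in
     (\<lambda>i. if i = 0 then x else if i = 1 then y^2 else if i = 2 then x * y^3 + x^3 * y else 0))"

end

theory Submission
  imports Defs "HOL-Complex_Analysis.Complex_Analysis" "HOL-Library.Landau_Symbols"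
begin

text \<open>
  If \<open>d = 2\<close>, the augmentation is an immersion, whereas \<open>C\<^sub>3\<close> is not. If \<open>d = 1\<close>, write
  \<open>A(y,z) = (f\<^bsub>g(z)\<^esub>(y), z)\<close> and let \<open>u\<close> be the third component of a coordinate change in the target such
  that \<open>C\<^sub>3 \<circ> \<theta> = (\<dots>, \<dots>, u) \<circ> A\<close>, so that \<open>u \<circ> A = \<theta>\<^sub>0 \<theta>\<^sub>1\<^sup>3 + \<theta>\<^sub>0\<^sup>3 \<theta>\<^sub>1\<close>. Comparing kernels of
  differentials gives \<open>f\<^sub>0(y) = a y\<^sup>2 + b y\<^sup>3 + \<dots>\<close>, \<open>\<theta>\<^sub>0(y,0) = O(y\<^sup>2)\<close> and
  \<open>p = \<partial>\<^sub>z\<theta>\<^sub>0(0) \<noteq> 0 \<noteq> q = \<partial>\<^sub>y\<theta>\<^sub>1(0)\<close>. On the axis \<open>z = 0\<close>, up to order 3 in \<open>y\<close>, the function \<open>u \<circ> A\<close>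
  vanishes and \<open>\<partial>\<^sub>z(u \<circ> A)\<close> equals \<open>p q\<^sup>3 y\<^sup>3\<close>. With \<open>\<alpha>\<close> the gradient of \<open>u\<close> in the first two
  variables at \<open>0\<close>, the former says that \<open>\<alpha>\<close> is orthogonal to \<open>a\<close> and \<open>b\<close>. Then stability of \<open>F\<close>
  forces \<open>a \<noteq> 0\<close> and \<open>\<alpha> \<cdot> \<partial>\<^sub>y\<partial>\<^sub>\<lambda>f \<noteq> 0\<close>, and the coefficient of \<open>y\<close> in \<open>\<partial>\<^sub>z(u \<circ> A)\<close> gives \<open>g'(0) = 0\<close>. What
  remains of \<open>\<partial>\<^sub>z(u \<circ> A)\<close> is \<open>u\<^sub>z(f\<^sub>0(y), 0)\<close>; its \<open>y\<^sup>2\<close>-coefficient \<open>B \<cdot> a\<close> vanishes, hence so does its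
  \<open>y\<^sup>3\<close>-coefficient \<open>B \<cdot> b\<close> since \<open>b\<close> is a multiple of \<open>a\<close>. This contradicts \<open>p q\<^sup>3 \<noteq> 0\<close>.
\<close>

section \<open>Germs at the origin and increments along coordinates\<close>

text \<open>A polydisc: moving one coordinate inside its disc does not leave the set, as
  one-variable arguments require. For \<open>n = 0\<close> it is the single point
  \<open>orig\<close>.\<close>

definition cube :: "nat \<Rightarrow> real \<Rightarrow> ('k::real_normed_field) vec set" where
  "cube n \<delta> = {v \<in> Kn n. \<forall>i<n. norm (v i) < \<delta>}"

text \<open>Neighbourhood filter of the origin of K^n. Identities of germs become eventual
  statements, which pull back along limits.\<close>

definition nb :: "nat \<Rightarrow> ('k::real_normed_field) vec filter" where
  "nb n = (INF \<delta>\<in>{0<..}. principal (cube n \<delta>))"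

lemma cube_mono: "\<delta> \<le> \<epsilon> \<Longrightarrow> cube n \<delta> \<subseteq> cube n \<epsilon>"
  by (auto simp: cube_def intro: less_le_trans)

lemma orig_in_cube [simp]: "\<delta> > 0 \<Longrightarrow> orig \<in> cube n \<delta>"
  by (auto simp: cube_def Kn_def)

lemma eventually_nb: "eventually P (nb n) \<longleftrightarrow> (\<exists>\<delta>>0. \<forall>v\<in>cube n \<delta>. P v)"
  unfolding nb_def
proof (subst eventually_INF_base)
  fix a b :: real assume "a \<in> {0<..}" "b \<in> {0<..}"
  then show "\<exists>x\<in>{0<..}. principal (cube n x) \<le> inf (principal (cube n a)) (principal (cube n b))"
    by (intro bexI[of _ "min a b"]) (auto simp: cube_mono)
qed (auto simp: eventually_principal)

lemma eventually_nb_orig: "eventually P (nb n) \<Longrightarrow> P orig"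
  by (auto simp: eventually_nb)

text \<open>Cubes are open in each coordinate, so a property near the origin persists on short
  coordinate segments through every nearby point. This lets germ identities be differentiated at
  points other than the origin.\<close>

lemma eventually_nb_eventually:
  assumes "eventually P (nb n)"
  shows "\<forall>\<^sub>F v in nb n. \<forall>i<n. \<forall>\<^sub>F t in nhds (v i). P (v(i := t))"
proof -
  obtain \<delta> where \<delta>: "\<delta> > 0" "\<And>v. v \<in> cube n \<delta> \<Longrightarrow> P v"
    using assms by (auto simp: eventually_nb)
  have "\<forall>\<^sub>F t in nhds (v i). P (v(i := t))" if v: "v \<in> cube n \<delta>" and i: "i < n" for v i
  proof -
    have "\<forall>\<^sub>F t in nhds (v i). t \<in> ball 0 \<delta>"
      using v i by (intro eventually_nhds_in_open) (auto simp: cube_def)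
    then show ?thesis
      by eventually_elim (use v i in \<open>auto intro!: \<delta>(2) simp: cube_def Kn_def\<close>)
  qed
  then show ?thesis
    using \<delta>(1) by (auto simp: eventually_nb)
qed

section \<open>Limits at the origin and comparison with open neighbourhoods\<close>

lemma filterlim_nb_iff:
  fixes h :: "'a \<Rightarrow> ('b::real_normed_field) vec"
  shows "filterlim h (nb p) F \<longleftrightarrow>
     (\<forall>\<^sub>F x in F. h x \<in> Kn p) \<and> (\<forall>i<p. ((\<lambda>x. h x i) \<longlongrightarrow> 0) F)" (is "?L = ?R")
proof
  assume L: ?L
  have ev: "\<forall>\<^sub>F x in F. h x \<in> cube p \<delta>" if "\<delta> > 0" for \<delta>
    using that L[unfolded filterlim_iff, rule_format, of "\<lambda>v. v \<in> cube p \<delta>"]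
    unfolding eventually_nb by blast
  have "\<forall>\<^sub>F x in F. h x \<in> Kn p"
    using ev[of 1] by (auto simp: cube_def elim: eventually_mono)
  moreover have "((\<lambda>x. h x i) \<longlongrightarrow> 0) F" if "i < p" for i
    unfolding tendsto_iff
  proof safe
    fix e :: real assume "e > 0"
    from ev[OF this] show "\<forall>\<^sub>F x in F. dist (h x i) 0 < e"
      by eventually_elim (use that in \<open>auto simp: cube_def\<close>)
  qed
  ultimately show ?R by auto
next
  assume R: ?R
  show ?L unfolding filterlim_iff eventually_nb
  proof safe
    fix P :: "'b vec \<Rightarrow> bool" and \<delta> :: real assume "\<delta> > 0" and P: "\<forall>v\<in>cube p \<delta>. P v"
    have "\<forall>\<^sub>F x in F. \<forall>i\<in>{..<p}. dist (h x i) 0 < \<delta>"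
      using R \<open>\<delta> > 0\<close> by (intro eventually_ball_finite) (auto simp: tendsto_iff)
    then show "\<forall>\<^sub>F x in F. P (h x)"
      using R[THEN conjunct1] by eventually_elim (use P in \<open>auto simp: cube_def\<close>)
  qed
qed

text \<open>Choose a basic open box around the origin. Only the first \<open>n\<close> coordinates
  have to be made small: on \<open>Kn n\<close> the others are 0, which lies in every factor of the
  box.\<close>

lemma nbhd0_eventually:
  fixes U :: "('k::real_normed_field) vec set"
  assumes "nbhd0 n U"
  shows "\<forall>\<^sub>F v in nb n. v \<in> U"
proof -
  obtain T where T: "open T" "U = Kn n \<inter> T" "orig \<in> T"
    using assms by (auto simp: nbhd0_def openin_open)
  obtain X where X: "orig \<in> Pi\<^sub>E UNIV X" "\<And>i. open (X i)" "finite {i. X i \<noteq> UNIV}" "Pi\<^sub>E UNIV X \<subseteq> T"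
    using product_topology_open_contains_basis[of "\<lambda>_. euclidean" UNIV T orig] T
    by (auto simp: open_fun_def)
  have "\<forall>\<^sub>F v in nb n. v i \<in> X i" if "i < n" for i
  proof -
    obtain e where e: "e > 0" "ball 0 e \<subseteq> X i"
      using PiE_mem[OF X(1), of i] X(2)[of i] by (force simp: open_contains_ball)
    then show ?thesis
      using that by (auto simp: eventually_nb cube_def subset_iff intro!: exI[of _ e])
  qed
  then have "\<forall>\<^sub>F v in nb n. \<forall>i\<in>{..<n}. v i \<in> X i"
    by (intro eventually_ball_finite) auto
  moreover have "\<forall>\<^sub>F v in nb n. v \<in> (Kn n :: 'k vec set)"
    by (auto simp: eventually_nb cube_def intro!: exI[of _ 1])
  ultimately show ?thesis
  proof eventually_elim
    case (elim v)
    have "v i \<in> X i" for i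
      using elim X(1) by (cases "i < n") (auto simp: Kn_def)
    then show ?case using elim X(4) T by (auto simp: PiE_def)
  qed
qed

lemma eventually_nb_Kn: "\<forall>\<^sub>F v in nb n. v \<in> Kn n"
  by (auto simp: eventually_nb cube_def intro!: exI[of _ 1])

lemma germ_eq_eventually: "germ_eq n f g \<Longrightarrow> \<forall>\<^sub>F v in nb n. f v = g v"
  by (auto simp: germ_eq_def dest!: nbhd0_eventually elim: eventually_mono)

text \<open>
  A common substitute for \<open>C\<^sup>\<infinity>\<close> and holomorphic germs: all iterated partial derivatives exist and
  are bounded near the origin.
\<close>

coinductive smooth_near :: "nat \<Rightarrow> (('k::real_normed_field) vec \<Rightarrow> 'k) \<Rightarrow> bool" for n where
  "\<lbrakk>\<forall>\<^sub>F v in nb n. norm (f v) \<le> C;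
    \<forall>\<^sub>F v in nb n. \<forall>i<n. (\<lambda>t. f (v(i := t))) field_differentiable at (v i);
    \<And>i. i < n \<Longrightarrow> smooth_near n (partial i f)\<rbrakk> \<Longrightarrow> smooth_near n f"

lemma smooth_near_bounded: "smooth_near n f \<Longrightarrow> \<exists>C. \<forall>\<^sub>F v in nb n. norm (f v) \<le> C"
  by (erule smooth_near.cases) auto

lemma smooth_near_differentiable:
  "smooth_near n f \<Longrightarrow> \<forall>\<^sub>F v in nb n. \<forall>i<n. (\<lambda>t. f (v(i := t))) field_differentiable at (v i)"
  by (erule smooth_near.cases) auto

lemma smooth_near_partial: "smooth_near n f \<Longrightarrow> i < n \<Longrightarrow> smooth_near n (partial i f)"
  by (erule smooth_near.cases) auto

lemma has_partial_derivative:
  "(\<lambda>t. f (v(i := t))) field_differentiable at (v i) \<Longrightarrow>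
   ((\<lambda>t. f (v(i := t))) has_field_derivative partial i f v) (at (v i))"
  by (simp add: partial_def DERIV_deriv_iff_field_differentiable)

lemma smooth_near_DERIV:
  assumes "smooth_near n f" "i < n"
  shows "\<forall>\<^sub>F v in nb n. ((\<lambda>t. f (v(i := t))) has_field_derivative partial i f v) (at (v i))"
  using smooth_near_differentiable[OF assms(1)]
  by eventually_elim (use assms(2) has_partial_derivative in auto)

lemma partial_eventually_cong:
  assumes "\<forall>\<^sub>F v in nb n. f v = g v" "i < n"
  shows "\<forall>\<^sub>F v in nb n. partial i f v = partial i g v"
  using eventually_nb_eventually[OF assms(1)]
  by eventually_elim (use assms(2) in \<open>auto simp: partial_def intro!: deriv_cong_ev\<close>)

text \<open>Pass from \<open>y\<close> to \<open>x\<close> one coordinate at a time and apply the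
  one-variable mean value inequality to each step. Taking \<open>c = 0\<close> yields a Lipschitz
  bound, taking for \<open>c\<close> the partial derivatives at \<open>y\<close> a second-order
  one.\<close>

lemma increment_bound:
  fixes f :: "('k::real_normed_field) vec \<Rightarrow> 'k"
  assumes conv: "\<And>i. i < n \<Longrightarrow> convex (S i)"
    and P: "P = {v \<in> Kn n. \<forall>i<n. v i \<in> S i}"
    and diff: "\<And>v i. v \<in> P \<Longrightarrow> i < n \<Longrightarrow> (\<lambda>t. f (v(i := t))) field_differentiable at (v i)"
    and B: "\<And>v i. v \<in> P \<Longrightarrow> i < n \<Longrightarrow> norm (partial i f v - c i) \<le> B"
    and xy: "x \<in> P" "y \<in> P"
  shows "norm (f x - f y - (\<Sum>i<n. c i * (x i - y i))) \<le> B * (\<Sum>i<n. norm (x i - y i))"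
proof -
  \<comment> \<open>Induction on \<open>m\<close>, where \<open>x\<close> may differ from
    \<open>y\<close> only in coordinates below \<open>m\<close>.\<close>
  have "norm (f x - f y - (\<Sum>i<n. c i * (x i - y i))) \<le> B * (\<Sum>i<n. norm (x i - y i))"
    if "m \<le> n" "x \<in> P" "y \<in> P" "\<And>i. i \<ge> m \<Longrightarrow> x i = y i" for m x
    using that
  proof (induction m arbitrary: x)
    case 0
    then have "x = y" by auto
    then show ?case by simp
  next
    case (Suc m)
    define x' where "x' = x(m := y m)"
    have m: "m < n" using Suc by simp
    have inP: "x(m := s) \<in> P" if "s \<in> S m" for s
      using Suc.prems(2) that m by (auto simp: P Kn_def)
    have Sm: "x m \<in> S m" "y m \<in> S m" using Suc.prems m by (auto simp: P)
    have x'P: "x' \<in> P" unfolding x'_def using inP Sm by blast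
    have IH: "norm (f x' - f y - (\<Sum>i<n. c i * (x' i - y i))) \<le> B * (\<Sum>i<n. norm (x' i - y i))"
    proof (rule Suc.IH)
      show "x' i = y i" if "m \<le> i" for i
        using Suc.prems(4)[of i] that by (cases "i = m") (auto simp: x'_def)
    qed (use m Suc.prems x'P in auto)
    have "norm ((f (x(m := x m)) - c m * x m) - (f (x(m := y m)) - c m * y m)) \<le> B * norm (x m - y m)"
    proof (rule field_differentiable_bound[OF conv[OF m], where f' = "\<lambda>s. partial m f (x(m := s)) - c m"])
      fix s assume s: "s \<in> S m"
      have "((\<lambda>t. f (x(m := t))) has_field_derivative partial m f (x(m := s))) (at s)"
        using has_partial_derivative[of f "x(m := s)" m, OF diff[OF inP[OF s] m]]
        by (simp only: fun_upd_upd fun_upd_same)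
      then show "((\<lambda>s. f (x(m := s)) - c m * s) has_field_derivative partial m f (x(m := s)) - c m)
                  (at s within S m)"
        using DERIV_cmult_Id[of "c m" s UNIV]
        by (rule has_field_derivative_at_within[OF DERIV_diff])
      show "norm (partial m f (x(m := s)) - c m) \<le> B"
        using B[OF inP[OF s] m] .
    qed (use Sm in auto)
    then have step: "norm (f x - f x' - c m * (x m - y m)) \<le> B * norm (x m - y m)"
      by (simp add: x'_def algebra_simps)
    have split: "(\<Sum>i<n. h i (x i)) = (\<Sum>i<n. h i (x' i)) + (h m (x m) - h m (y m))"
      for h :: "nat \<Rightarrow> 'k \<Rightarrow> 'c::ab_group_add"
    proof -
      have "(\<Sum>i<n. h i (x i)) = h m (x m) + (\<Sum>i\<in>{..<n} - {m}. h i (x i))"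
        using m by (subst sum.remove[of _ m]) auto
      moreover have "(\<Sum>i<n. h i (x' i)) = h m (y m) + (\<Sum>i\<in>{..<n} - {m}. h i (x' i))"
        using m by (subst sum.remove[of _ m]) (auto simp: x'_def)
      moreover have "(\<Sum>i\<in>{..<n} - {m}. h i (x' i)) = (\<Sum>i\<in>{..<n} - {m}. h i (x i))"
        by (rule sum.cong) (auto simp: x'_def)
      ultimately show ?thesis by simp
    qed
    have s1: "(\<Sum>i<n. c i * (x i - y i)) = (\<Sum>i<n. c i * (x' i - y i)) + c m * (x m - y m)"
      using split[of "\<lambda>i t. c i * (t - y i)"] by simp
    have s2: "(\<Sum>i<n. norm (x i - y i)) = (\<Sum>i<n. norm (x' i - y i)) + norm (x m - y m)"
      using split[of "\<lambda>i t. norm (t - y i)"] by simp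
    have rearrange: "a - b - (s + d) = (a' - b - s) + (a - a' - d)" for a b s d a' :: 'k
      by simp
    have "norm (f x - f y - (\<Sum>i<n. c i * (x i - y i)))
        = norm ((f x' - f y - (\<Sum>i<n. c i * (x' i - y i))) + (f x - f x' - c m * (x m - y m)))"
      unfolding s1 by (rule arg_cong[of _ _ norm]) (rule rearrange)
    also have "\<dots> \<le> B * (\<Sum>i<n. norm (x' i - y i)) + B * norm (x m - y m)"
      by (rule norm_triangle_le) (use IH step in linarith)
    also have "\<dots> = B * (\<Sum>i<n. norm (x i - y i))"
      by (simp add: s2 algebra_simps)
    finally show ?case .
  qed
  from this[of n x] xy show ?thesis by (auto simp: P Kn_def)
qed

section \<open>First-order expansion, chain rule and Taylor polynomials\<close>

lemma eventually_norm_bounded_finite: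
  assumes "\<And>i. i < n \<Longrightarrow> \<exists>C. \<forall>\<^sub>F v in F. norm (g i v) \<le> C"
  shows "\<exists>C\<ge>0. \<forall>\<^sub>F v in F. \<forall>i<(n::nat). norm (g i v) \<le> C"
  using assms
proof (induction n)
  case 0
  show ?case by (intro exI[of _ 0]) simp
next
  case (Suc n)
  obtain C where C: "C \<ge> 0" "\<forall>\<^sub>F v in F. \<forall>i<n. norm (g i v) \<le> C"
    using Suc.IH[OF Suc.prems] by auto
  obtain D where "\<forall>\<^sub>F v in F. norm (g n v) \<le> D"
    using Suc.prems[of n] by auto
  with C(2) have "\<forall>\<^sub>F v in F. \<forall>i<Suc n. norm (g i v) \<le> max C D"
    by eventually_elim (force simp: less_Suc_eq le_max_iff_disj)
  then show ?case using C(1) by (intro exI[of _ "max C D"]) auto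
qed

section \<open>Lipschitz and quadratic estimates\<close>

lemma smooth_near_Lipschitz:
  assumes "smooth_near n f"
  shows "\<exists>L\<ge>0. \<exists>\<delta>>0. \<forall>x\<in>cube n \<delta>. \<forall>y\<in>cube n \<delta>. norm (f x - f y) \<le> L * (\<Sum>i<n. norm (x i - y i))"
proof -
  obtain C where C: "C \<ge> 0" "\<forall>\<^sub>F v in nb n. \<forall>i<n. norm (partial i f v) \<le> C"
    using eventually_norm_bounded_finite[where n = n and F = "nb n" and g = "\<lambda>i. partial i f"]
      smooth_near_bounded[OF smooth_near_partial[OF assms]] by auto
  have "\<forall>\<^sub>F v in nb n. \<forall>i<n. (\<lambda>t. f (v(i := t))) field_differentiable at (v i) \<and>
          norm (partial i f v) \<le> C"
    using C(2) smooth_near_differentiable[OF assms] by eventually_elim auto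
  then obtain \<delta> where \<delta>: "\<delta> > 0" "\<And>v i. v \<in> cube n \<delta> \<Longrightarrow> i < n \<Longrightarrow>
      (\<lambda>t. f (v(i := t))) field_differentiable at (v i)"
      "\<And>v i. v \<in> cube n \<delta> \<Longrightarrow> i < n \<Longrightarrow> norm (partial i f v) \<le> C"
    unfolding eventually_nb by blast
  have "norm (f x - f y) \<le> C * (\<Sum>i<n. norm (x i - y i))"
    if "x \<in> cube n \<delta>" "y \<in> cube n \<delta>" for x y
    using increment_bound[of n "\<lambda>_. ball 0 \<delta>" "cube n \<delta>" f "\<lambda>_. 0" C x y] \<delta> that
    by (auto simp: cube_def)
  then show ?thesis using \<delta>(1) C(1) by blast
qed

text \<open>The partial derivatives are themselves Lipschitz, so on a box between \<open>y\<close>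
  and \<open>x\<close> they differ from their values at \<open>y\<close> by a multiple of the
  distance; \<open>increment_bound\<close> supplies the second factor.\<close>

lemma smooth_near_quadratic:
  assumes "smooth_near n f"
  shows "\<exists>C\<ge>0. \<exists>\<delta>>0. \<forall>x\<in>cube n \<delta>. \<forall>y\<in>cube n \<delta>.
    norm (f x - f y - (\<Sum>i<n. partial i f y * (x i - y i))) \<le> C * (\<Sum>i<n. norm (x i - y i))\<^sup>2"
proof -
  have "\<exists>L\<ge>0. \<exists>\<delta>>0. \<forall>i<n. \<forall>x\<in>cube n \<delta>. \<forall>y\<in>cube n \<delta>.
      norm (partial i f x - partial i f y) \<le> L * (\<Sum>i<n. norm (x i - y i))"
  proof -
    have "\<forall>i\<in>{..<n}. \<exists>p. fst p \<ge> 0 \<and> snd p > 0 \<and> (\<forall>x\<in>cube n (snd p). \<forall>y\<in>cube n (snd p).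
      norm (partial i f x - partial i f y) \<le> fst p * (\<Sum>i<n. norm (x i - y i)))"
      using smooth_near_Lipschitz[OF smooth_near_partial[OF assms]] by simp
    then obtain p where p: "\<And>i. i < n \<Longrightarrow> fst (p i) \<ge> 0 \<and> snd (p i) > 0 \<and>
        (\<forall>x\<in>cube n (snd (p i)). \<forall>y\<in>cube n (snd (p i)).
      norm (partial i f x - partial i f y) \<le> fst (p i) * (\<Sum>i<n. norm (x i - y i)))"
      unfolding bchoice_iff by auto
    define L where "L = (\<Sum>i<n. fst (p i))"
    \<comment> \<open>Inserting 1 keeps the minimum over a nonempty set when
      \<open>n = 0\<close>.\<close>
    define \<delta> where "\<delta> = Min (insert 1 ((\<lambda>i. snd (p i)) ` {..<n}))"
    have "L \<ge> 0" using p by (auto simp: L_def intro!: sum_nonneg)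
    moreover have "\<delta> > 0" using p by (auto simp: \<delta>_def)
    moreover have "norm (partial i f x - partial i f y) \<le> L * (\<Sum>i<n. norm (x i - y i))"
      if "i < n" "x \<in> cube n \<delta>" "y \<in> cube n \<delta>" for i x y
    proof -
      have "\<delta> \<le> snd (p i)" using that by (auto simp: \<delta>_def)
      then have "norm (partial i f x - partial i f y) \<le> fst (p i) * (\<Sum>i<n. norm (x i - y i))"
        using p[OF that(1)] that cube_mono by blast
      also have "fst (p i) \<le> L"
        unfolding L_def using p that(1) by (intro member_le_sum) auto
      finally show ?thesis
        by (simp add: sum_nonneg mult_right_mono)
    qed
    ultimately show ?thesis by blast
  qed
  then obtain L \<delta> where L: "L \<ge> 0" "\<delta> > 0"
    "\<And>i x y. i < n \<Longrightarrow> x \<in> cube n \<delta> \<Longrightarrow> y \<in> cube n \<delta> \<Longrightarrow>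
      norm (partial i f x - partial i f y) \<le> L * (\<Sum>i<n. norm (x i - y i))"
    by blast
  obtain \<epsilon> where \<epsilon>: "\<epsilon> > 0" "\<And>v i. v \<in> cube n \<epsilon> \<Longrightarrow> i < n \<Longrightarrow>
      (\<lambda>t. f (v(i := t))) field_differentiable at (v i)"
    using smooth_near_differentiable[OF assms] unfolding eventually_nb by blast
  define \<gamma> where "\<gamma> = min \<delta> \<epsilon>"
  have sub: "cube n \<gamma> \<subseteq> cube n \<delta>" "cube n \<gamma> \<subseteq> cube n \<epsilon>"
    by (auto simp: \<gamma>_def intro!: cube_mono)
  have "norm (f x - f y - (\<Sum>i<n. partial i f y * (x i - y i))) \<le> L * (\<Sum>i<n. norm (x i - y i))\<^sup>2"
    if xy: "x \<in> cube n \<gamma>" "y \<in> cube n \<gamma>" for x y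
  proof -
    \<comment> \<open>The box contains \<open>x\<close> and \<open>y\<close>, and none of its points
      is farther from \<open>y\<close> in any coordinate than \<open>x\<close> is.\<close>
    define S where "S i = cball (y i) (norm (x i - y i)) \<inter> ball 0 \<gamma>" for i
    define P where "P = {v \<in> Kn n. \<forall>i<n. v i \<in> S i}"
    have P: "P \<subseteq> cube n \<gamma>" by (auto simp: P_def S_def cube_def)
    have "norm (f x - f y - (\<Sum>i<n. partial i f y * (x i - y i)))
        \<le> (L * (\<Sum>i<n. norm (x i - y i))) * (\<Sum>i<n. norm (x i - y i))"
    proof (rule increment_bound[OF _ P_def])
      show "convex (S i)" for i by (auto simp: S_def intro!: convex_Int)
      fix v i assume v: "v \<in> P" and i: "i < n"
      show "(\<lambda>t. f (v(i := t))) field_differentiable at (v i)"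
        by (rule \<epsilon>(2)[OF _ i]) (use v sub P in auto)
      have "norm (partial i f v - partial i f y) \<le> L * (\<Sum>i<n. norm (v i - y i))"
        by (rule L(3)[OF i]) (use v xy sub P in auto)
      also have "(\<Sum>i<n. norm (v i - y i)) \<le> (\<Sum>i<n. norm (x i - y i))"
        using v by (intro sum_mono) (auto simp: P_def S_def dist_norm norm_minus_commute)
      finally show "norm (partial i f v - partial i f y) \<le> L * (\<Sum>i<n. norm (x i - y i))"
        using L(1) by (simp add: mult_left_mono)
    qed (use xy in \<open>auto simp: P_def S_def cube_def dist_norm norm_minus_commute\<close>)
    then show ?thesis by (simp add: power2_eq_square)
  qed
  moreover have "\<gamma> > 0" using L \<epsilon> by (simp add: \<gamma>_def)
  ultimately show ?thesis using L(1) by blast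
qed

lemma filterlim_nb_cube: "filterlim h (nb n) F \<Longrightarrow> \<delta> > 0 \<Longrightarrow> \<forall>\<^sub>F t in F. h t \<in> cube n \<delta>"
  unfolding filterlim_iff by (erule allE[of _ "\<lambda>v. v \<in> cube n \<delta>"]) (auto simp: eventually_nb)

lemma smooth_near_tendsto:
  assumes "smooth_near n f" "filterlim h (nb n) F"
  shows "((\<lambda>t. f (h t)) \<longlongrightarrow> f orig) F"
proof -
  obtain L \<delta> where L: "\<delta> > 0" "\<And>x y. x \<in> cube n \<delta> \<Longrightarrow> y \<in> cube n \<delta> \<Longrightarrow>
      norm (f x - f y) \<le> L * (\<Sum>i<n. norm (x i - y i))"
    using smooth_near_Lipschitz[OF assms(1)] by blast
  have "\<forall>\<^sub>F t in F. norm (f (h t) - f orig) \<le> L * (\<Sum>i<n. norm (h t i))"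
    using filterlim_nb_cube[OF assms(2) L(1)]
    by eventually_elim (use L(2)[of _ orig] L(1) in auto)
  moreover have "((\<lambda>t. L * (\<Sum>i<n. norm (h t i))) \<longlongrightarrow> L * (\<Sum>i<n. 0)) F"
    using assms(2) by (intro tendsto_intros tendsto_norm_zero) (auto simp: filterlim_nb_iff)
  ultimately have "((\<lambda>t. f (h t) - f orig) \<longlongrightarrow> 0) F"
    by (auto intro: Lim_null_comparison[where g = "\<lambda>t. L * (\<Sum>i<n. norm (h t i))"])
  then show ?thesis by (simp add: LIM_zero_iff)
qed

text \<open>This is the quadratic estimate with base point \<open>orig\<close>. For
  \<open>r t = t^2\<close> the error is O(t^4), so the linear part of \<open>f\<close> alone
  determines the composite up to order 3.\<close>

lemma smooth_near_first_order:
  assumes f: "smooth_near n f" and h: "filterlim h (nb n) F"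
    and O: "\<And>i. i < n \<Longrightarrow> (\<lambda>t. h t i) \<in> O[F](r)"
  shows "(\<lambda>t. f (h t) - f orig - (\<Sum>i<n. partial i f orig * h t i)) \<in> O[F](\<lambda>t. (r t)\<^sup>2)"
proof -
  obtain C \<delta> where C: "\<delta> > 0" "\<And>x y. x \<in> cube n \<delta> \<Longrightarrow> y \<in> cube n \<delta> \<Longrightarrow>
      norm (f x - f y - (\<Sum>i<n. partial i f y * (x i - y i))) \<le> C * (\<Sum>i<n. norm (x i - y i))\<^sup>2"
    using smooth_near_quadratic[OF f] by blast
  have "(\<lambda>t. f (h t) - f orig - (\<Sum>i<n. partial i f orig * h t i)) \<in>
      O[F](\<lambda>t. (\<Sum>i<n. of_real (norm (h t i)))\<^sup>2)"
  proof (rule bigoI[of _ C])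
    show "\<forall>\<^sub>F t in F. norm (f (h t) - f orig - (\<Sum>i<n. partial i f orig * h t i))
        \<le> C * norm ((\<Sum>i<n. of_real (norm (h t i)))\<^sup>2 :: 'a)"
      using filterlim_nb_cube[OF h C(1)]
    proof eventually_elim
      case (elim t)
      show ?case using C(2)[OF elim, of orig] C(1)
        by (simp add: norm_power flip: of_real_sum)
    qed
  qed
  also have "(\<lambda>t. (\<Sum>i<n. of_real (norm (h t i)))\<^sup>2 :: 'a) \<in> O[F](\<lambda>t. (r t)\<^sup>2)"
    using O by (intro landau_o.big_power big_sum_in_bigo) (auto simp: landau_o.big.norm_iff bigo_def)
  finally show ?thesis .
qed

text \<open>The quadratic remainder disappears in the difference quotient. The curves are quantified
  inside the eventual statement, so the rule also applies at a moving base point.\<close>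

lemma smooth_near_chain:
  fixes f :: "('k::real_normed_field) vec \<Rightarrow> 'k"
  assumes f: "smooth_near n f"
  shows "\<forall>\<^sub>F y in nb n. \<forall>\<gamma> \<gamma>' t0. \<gamma> t0 = y \<longrightarrow> (\<forall>\<^sub>F t in nhds t0. \<gamma> t \<in> Kn n) \<longrightarrow>
     (\<forall>i<n. ((\<lambda>t. \<gamma> t i) has_field_derivative \<gamma>' i) (at t0)) \<longrightarrow>
     ((\<lambda>t. f (\<gamma> t)) has_field_derivative (\<Sum>i<n. partial i f y * \<gamma>' i)) (at t0)"
proof -
  obtain C \<delta> where C: "\<delta> > 0" "\<And>x y. x \<in> cube n \<delta> \<Longrightarrow> y \<in> cube n \<delta> \<Longrightarrow>
      norm (f x - f y - (\<Sum>i<n. partial i f y * (x i - y i))) \<le> C * (\<Sum>i<n. norm (x i - y i))\<^sup>2"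
    using smooth_near_quadratic[OF f] by blast
  have "((\<lambda>t. f (\<gamma> t)) has_field_derivative (\<Sum>i<n. partial i f y * \<gamma>' i)) (at t0)"
    if y: "y \<in> cube n \<delta>" "\<gamma> t0 = y" and Kn: "\<forall>\<^sub>F t in nhds t0. \<gamma> t \<in> Kn n"
      and d: "\<And>i. i < n \<Longrightarrow> ((\<lambda>t. \<gamma> t i) has_field_derivative \<gamma>' i) (at t0)" for y \<gamma> \<gamma>' t0
  proof -
    define q where "q i t = (\<gamma> t i - y i) / (t - t0)" for i t
    have q: "(q i \<longlongrightarrow> \<gamma>' i) (at t0)" if "i < n" for i
      using d[OF that] y(2) unfolding q_def has_field_derivative_iff by simp
    have lim: "((\<lambda>t. \<gamma> t i) \<longlongrightarrow> y i) (at t0)" if "i < n" for i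
      using DERIV_isCont[OF d[OF that]] y(2) by (simp add: isCont_def)
    have near: "\<forall>\<^sub>F t in at t0. \<gamma> t \<in> cube n \<delta>"
    proof -
      have "\<forall>\<^sub>F t in at t0. \<forall>i\<in>{..<n}. norm (\<gamma> t i) < \<delta>"
        using y(1) lim
        by (intro eventually_ball_finite ballI order_tendstoD(2)[OF tendsto_norm])
           (auto simp: cube_def)
      moreover have "\<forall>\<^sub>F t in at t0. \<gamma> t \<in> Kn n"
        using Kn by (auto simp: eventually_at_filter elim: eventually_mono)
      ultimately show ?thesis by eventually_elim (auto simp: cube_def)
    qed
    \<comment> \<open>The bound is a product of increments, which tend to 0, and of difference
      quotients of the coordinates, which converge.\<close>
    have "((\<lambda>t. (f (\<gamma> t) - f (\<gamma> t0)) / (t - t0) - (\<Sum>i<n. partial i f y * q i t)) \<longlongrightarrow> 0) (at t0)"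
    proof (rule Lim_null_comparison)
      show "\<forall>\<^sub>F t in at t0. norm ((f (\<gamma> t) - f (\<gamma> t0)) / (t - t0) - (\<Sum>i<n. partial i f y * q i t))
          \<le> C * (\<Sum>i<n. norm (\<gamma> t i - y i)) * (\<Sum>i<n. norm (q i t))"
        using near eventually_neq_at_within[of t0 t0 UNIV]
      proof eventually_elim
        case (elim t)
        have e1: "(f (\<gamma> t) - f (\<gamma> t0)) / (t - t0) - (\<Sum>i<n. partial i f y * q i t)
            = (f (\<gamma> t) - f y - (\<Sum>i<n. partial i f y * (\<gamma> t i - y i))) / (t - t0)"
          using y(2) by (simp add: q_def diff_divide_distrib[of "_ - _"] sum_divide_distrib)
        have e2: "(\<Sum>i<n. norm (q i t)) = (\<Sum>i<n. norm (\<gamma> t i - y i)) / norm (t - t0)"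
          by (simp add: q_def norm_divide sum_divide_distrib)
        show ?case unfolding e1 e2 norm_divide
          using C(2)[OF elim(1) y(1)] elim(2)
          by (simp add: power2_eq_square divide_right_mono mult.assoc)
      qed
      have "((\<lambda>t. C * (\<Sum>i<n. norm (\<gamma> t i - y i)) * (\<Sum>i<n. norm (q i t))) \<longlongrightarrow>
          C * (\<Sum>i<n. norm (y i - y i)) * (\<Sum>i<n. norm (\<gamma>' i))) (at t0)"
        using lim q by (intro tendsto_intros) auto
      then show "((\<lambda>t. C * (\<Sum>i<n. norm (\<gamma> t i - y i)) * (\<Sum>i<n. norm (q i t))) \<longlongrightarrow> 0) (at t0)"
        by simp
    qed
    moreover have "((\<lambda>t. \<Sum>i<n. partial i f y * q i t) \<longlongrightarrow> (\<Sum>i<n. partial i f y * \<gamma>' i)) (at t0)"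
      using q by (intro tendsto_intros) auto
    ultimately show ?thesis
      unfolding has_field_derivative_iff by (auto dest: Lim_transform)
  qed
  then show ?thesis unfolding eventually_nb using C(1) by blast
qed

section \<open>Taylor expansion along a coordinate axis\<close>

lemma filterlim_axis:
  assumes "i < n"
  shows "filterlim (\<lambda>t::'k::real_normed_field. orig(i := t)) (nb n) (nhds 0)"
proof -
  have "((\<lambda>t::'k. (orig(i := t)) j) \<longlongrightarrow> 0) (nhds 0)" for j
    by (cases "j = i") (simp_all add: filterlim_ident)
  then show ?thesis
    using assms by (simp add: filterlim_nb_iff Kn_def)
qed

text \<open>Iterated partial derivatives are the successive derivatives along the axis, and the one
  of order \<open>Suc N\<close> is bounded near the origin, so the one-variable Taylor estimate
  applies.\<close>

lemma smooth_near_Taylor: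
  fixes f :: "('k::real_normed_field) vec \<Rightarrow> 'k"
  assumes f: "smooth_near n f" and i: "i < n"
  shows "(\<lambda>t. f (orig(i := t)) - (\<Sum>m\<le>N. (partial i ^^ m) f orig * t ^ m / fact m)) \<in> O[at 0](\<lambda>t. t ^ Suc N)"
proof -
  have sm: "smooth_near n ((partial i ^^ m) f)" for m
    by (induction m) (use f i smooth_near_partial in auto)
  obtain C where C: "\<forall>\<^sub>F v in nb n. norm ((partial i ^^ Suc N) f v) \<le> C"
    using smooth_near_bounded[OF sm] by blast
  have "\<forall>\<^sub>F v in nb n. \<forall>m\<in>{..N}. ((\<lambda>t. (partial i ^^ m) f (v(i := t))) has_field_derivative
          (partial i ^^ Suc m) f v) (at (v i))"
    using smooth_near_DERIV[OF sm i] by (intro eventually_ball_finite) auto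
  with C have "\<forall>\<^sub>F v in nb n. norm ((partial i ^^ Suc N) f v) \<le> C \<and>
      (\<forall>m\<le>N. ((\<lambda>t. (partial i ^^ m) f (v(i := t))) has_field_derivative
          (partial i ^^ Suc m) f v) (at (v i)))"
    by eventually_elim auto
  then obtain \<delta> where \<delta>: "\<delta> > 0" "\<And>v. v \<in> cube n \<delta> \<Longrightarrow> norm ((partial i ^^ Suc N) f v) \<le> C"
      "\<And>v m. v \<in> cube n \<delta> \<Longrightarrow> m \<le> N \<Longrightarrow>((\<lambda>t. (partial i ^^ m) f (v(i := t))) has_field_derivative
          (partial i ^^ Suc m) f v) (at (v i))"
    unfolding eventually_nb by blast
  have ax: "orig(i := t) \<in> cube n \<delta>" if "t \<in> ball 0 \<delta>" for t :: 'k
    using that i \<delta>(1) by (auto simp: cube_def Kn_def)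
  show ?thesis
  proof (rule bigoI[of _ "C / fact N"])
    have "\<forall>\<^sub>F t in at 0. t \<in> ball 0 \<delta>"
      using \<delta>(1) by (intro eventually_at_in_open') auto
    then show "\<forall>\<^sub>F t in at 0. norm (f (orig(i := t)) - (\<Sum>m\<le>N. (partial i ^^ m) f orig * t ^ m / fact m))
        \<le> C / fact N * norm (t ^ Suc N)"
    proof eventually_elim
      case (elim t)
      define g where "g m s = (partial i ^^ m) f (orig(i := s))" for m s
      have "norm (g 0 t - (\<Sum>m\<le>N. g m 0 * (t - 0) ^ m / fact m)) \<le> C * norm (t - 0) ^ Suc N / fact N"
      proof (rule field_Taylor[where S = "ball 0 \<delta>"])
        fix m :: nat and s :: 'k assume s: "s \<in> ball 0 \<delta>" and m: "m \<le> N"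
        show "(g m has_field_derivative g (Suc m) s) (at s within ball 0 \<delta>)"
          unfolding g_def
          by (rule has_field_derivative_at_within)
            (use \<delta>(3)[OF ax[OF s] m] in \<open>simp only: fun_upd_upd fun_upd_same\<close>)
      next
        fix s :: 'k assume s: "s \<in> ball 0 \<delta>"
        show "norm (g (Suc N) s) \<le> C" unfolding g_def using \<delta>(2)[OF ax[OF s]] .
      qed (use elim \<delta>(1) in auto)
      moreover have "g m 0 = (partial i ^^ m) f orig" for m
        by (simp add: g_def fun_upd_idem)
      ultimately show ?case by (simp add: g_def norm_mult norm_power del: fun_upd_apply)
    qed
  qed
qed

text \<open>Coefficients are peeled off from the lowest: the constant term is a limit, hence 0, and
  dividing by \<open>t\<close> lowers the exponent of the bound by one.\<close>

lemma poly_coeff_eq_0_if_bigo: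
  fixes c0 c1 c2 c3 :: "'k::real_normed_field"
  assumes "(\<lambda>t. c0 + c1 * t + c2 * t\<^sup>2 + c3 * t ^ 3) \<in> O[at 0](\<lambda>t. t ^ N)"
  shows "N \<ge> 1 \<Longrightarrow> c0 = 0" "N \<ge> 2 \<Longrightarrow> c1 = 0" "N \<ge> 3 \<Longrightarrow> c2 = 0" "N \<ge> 4 \<Longrightarrow> c3 = 0"
proof -
  have *: "a = 0 \<and> (\<lambda>t. p t) \<in> O[at 0](\<lambda>t. t ^ N)"
    if O: "(\<lambda>t. a + t * p t) \<in> O[at 0](\<lambda>t. t ^ Suc N)" and p: "isCont p 0"
    for a :: 'k and p N
  proof -
    have "((\<lambda>t. a + t * p t) \<longlongrightarrow> a + 0 * p 0) (at 0)"
      using p by (intro tendsto_intros) (auto simp: isCont_def)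
    moreover have "((\<lambda>t. a + t * p t) \<longlongrightarrow> 0) (at 0)"
    proof -
      obtain C where C: "\<forall>\<^sub>F t in at 0. norm (a + t * p t) \<le> C * norm (t ^ Suc N)"
        using landau_o.bigE[OF O] by blast
      have "((\<lambda>t::'k. C * norm (t ^ Suc N)) \<longlongrightarrow> C * norm (0 ^ Suc N :: 'k)) (at 0)"
        by (intro tendsto_intros)
      with C show ?thesis by (intro Lim_null_comparison[OF C]) auto
    qed
    ultimately have "a = 0"
      using tendsto_unique[OF at_neq_bot] by force
    moreover have "(\<lambda>t. t * p t) \<in> O[at 0](\<lambda>t. t * t ^ N)"
      using O calculation by simp
    then have "p \<in> O[at 0](\<lambda>t. t ^ N)"
      by (subst (asm) landau_o.big.mult_cancel_left) (auto simp: eventually_at_filter)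
    ultimately show ?thesis by simp
  qed
  \<comment> \<open>Horner form; the final \<open>t * 0\<close> gives all four peeling steps the
    same shape.\<close>
  have "(\<lambda>t. c0 + c1 * t + c2 * t\<^sup>2 + c3 * t ^ 3) = (\<lambda>t. c0 + t * (c1 + t * (c2 + t * (c3 + t * 0))))"
    by (simp add: fun_eq_iff algebra_simps power2_eq_square power3_eq_cube)
  with assms have O: "(\<lambda>t. c0 + t * (c1 + t * (c2 + t * (c3 + t * 0)))) \<in> O[at 0](\<lambda>t. t ^ N)"
    by (simp only:)
  have 1: "c0 = 0 \<and> (\<lambda>t. c1 + t * (c2 + t * (c3 + t * 0))) \<in> O[at 0](\<lambda>t. t ^ (N - 1))" if "N \<ge> 1"
  proof (rule *)
    have "N = Suc (N - 1)" using that by simp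
    then show "(\<lambda>t. c0 + t * (c1 + t * (c2 + t * (c3 + t * 0)))) \<in> O[at 0](\<lambda>t. t ^ Suc (N - 1))"
      using O by simp
  qed (intro continuous_intros)
  have 2: "c1 = 0 \<and> (\<lambda>t. c2 + t * (c3 + t * 0)) \<in> O[at 0](\<lambda>t. t ^ (N - 2))" if "N \<ge> 2"
  proof (rule *)
    have "N - 1 = Suc (N - 2)" using that by simp
    then show "(\<lambda>t. c1 + t * (c2 + t * (c3 + t * 0))) \<in> O[at 0](\<lambda>t. t ^ Suc (N - 2))"
      using 1 that by auto
  qed (intro continuous_intros)
  have 3: "c2 = 0 \<and> (\<lambda>t. c3 + t * 0) \<in> O[at 0](\<lambda>t. t ^ (N - 3))" if "N \<ge> 3"
  proof (rule *)
    have "N - 2 = Suc (N - 3)" using that by simp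
    then show "(\<lambda>t. c2 + t * (c3 + t * 0)) \<in> O[at 0](\<lambda>t. t ^ Suc (N - 3))"
      using 2 that by auto
  qed (intro continuous_intros)
  have 4: "c3 = 0 \<and> (\<lambda>t::'k. 0::'k) \<in> O[at 0](\<lambda>t. t ^ (N - 4))" if "N \<ge> 4"
  proof (rule *)
    have "N - 3 = Suc (N - 4)" using that by simp
    then show "(\<lambda>t. c3 + t * 0) \<in> O[at 0](\<lambda>t. t ^ Suc (N - 4))"
      using 3 that by auto
  qed (intro continuous_intros)
  show "N \<ge> 1 \<Longrightarrow> c0 = 0" "N \<ge> 2 \<Longrightarrow> c1 = 0" "N \<ge> 3 \<Longrightarrow> c2 = 0" "N \<ge> 4 \<Longrightarrow> c3 = 0"
    using 1 2 3 4 by auto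
qed

section \<open>Real and complex scalars\<close>

text \<open>The class of scalars has no axiom about \<open>smooth_fun_on\<close>; these two
  properties are what the argument takes from the field. The first gives estimates, the second the
  test vector fields for stability.\<close>

locale tame_scalar =
  fixes K :: "'k::smooth_scalar itself"
  assumes smooth_fun_on_near:
      "nbhd0 n U \<Longrightarrow> smooth_fun_on n U f \<Longrightarrow> smooth_near n (f :: 'k vec \<Rightarrow> 'k)"
    and smooth_fun_on_monomial: "smooth_fun_on n (Kn n) (\<lambda>v :: 'k vec. c * v i ^ m)"

section \<open>Local bounds, monomials and the real case\<close>

lemma continuous_on_bounded_near:
  fixes f :: "('k::real_normed_field) vec \<Rightarrow> 'k"
  assumes "nbhd0 n U" "continuous_on U f"
  shows "\<exists>C. \<forall>\<^sub>F v in nb n. norm (f v) \<le> C"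
proof -
  have "openin (top_of_set U) (U \<inter> f -` ball (f orig) 1)"
    using assms(2) by (rule continuous_openin_preimage_gen) simp
  then have "nbhd0 n (U \<inter> f -` ball (f orig) 1)"
    using assms(1) by (auto simp: nbhd0_def intro: openin_trans)
  then have "\<forall>\<^sub>F v in nb n. v \<in> U \<inter> f -` ball (f orig) 1"
    by (rule nbhd0_eventually)
  then have "\<forall>\<^sub>F v in nb n. norm (f v) \<le> norm (f orig) + 1"
  proof eventually_elim
    case (elim v)
    then have "norm (f v - f orig) < 1" by (simp add: dist_norm norm_minus_commute)
    then show ?case using norm_triangle_ineq2[of "f v" "f orig"] by linarith
  qed
  then show ?thesis by blast
qed

lemma has_partials_on_near:
  "nbhd0 n U \<Longrightarrow> has_partials_on n U f \<Longrightarrow>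
   \<forall>\<^sub>F v in nb n. \<forall>i<n. (\<lambda>t. f (v(i := t))) field_differentiable at (v i)"
  by (drule nbhd0_eventually) (auto simp: has_partials_on_def elim: eventually_mono)

text \<open>Partial derivatives of these monomials are again of the same form, which drives the
  induction for \<open>Ck_on\<close>. For \<open>m = 0\<close> the truncated exponent is harmless
  because the coefficient is 0.\<close>

lemma partial_monomial:
  "partial j (\<lambda>v. c * v i ^ m) =
    (\<lambda>v. (if j = i then c * of_nat m else 0) * v i ^ (m - 1))"
proof
  fix v :: "'a vec"
  show "partial j (\<lambda>v. c * v i ^ m) v = (if j = i then c * of_nat m else 0) * v i ^ (m - 1)"
  proof (cases "j = i")
    case True
    have "((\<lambda>t. c * t ^ m) has_field_derivative c * (of_nat m * v i ^ (m - 1))) (at (v i))"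
      by (auto intro!: derivative_eq_intros)
    then show ?thesis using True by (simp add: partial_def DERIV_imp_deriv mult.assoc)
  qed (simp add: partial_def)
qed

lemma has_partials_on_monomial: "has_partials_on n U (\<lambda>v. c * v i ^ m)"
  unfolding has_partials_on_def
proof (intro ballI allI impI)
  fix v :: "'a vec" and j
  show "(\<lambda>t. c * (v(j := t)) i ^ m) field_differentiable at (v j)"
    by (cases "j = i") (auto intro!: derivative_intros)
qed

lemma continuous_on_monomial: "continuous_on U (\<lambda>v::('k::real_normed_field) vec. c * v i ^ m)"
  by (intro continuous_intros continuous_on_subset[OF continuous_on_product_coordinates]) auto

lemma Ck_on_monomial: "Ck_on n U k (\<lambda>v. c * v i ^ m)"
  by (induction k arbitrary: c m)
     (simp_all add: continuous_on_monomial has_partials_on_monomial partial_monomial)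

interpretation real: tame_scalar "TYPE(real)"
proof
  fix n U and f :: "real vec \<Rightarrow> real"
  assume U: "nbhd0 n U" and f: "smooth_fun_on n U f"
  from f have "\<forall>k. Ck_on n U k f" by (simp add: smooth_fun_on_real_def)
  then show "smooth_near n f"
  \<comment> \<open>The invariant is \<open>Ck_on\<close> for all \<open>k\<close> on the fixed set
    \<open>U\<close>; partial derivatives inherit it through \<open>Suc k\<close>.\<close>
  proof (coinduction arbitrary: f)
    case smooth_near
    then have "Ck_on n U 0 f" by blast
    then obtain C where "\<forall>\<^sub>F v in nb n. norm (f v) \<le> C"
      using continuous_on_bounded_near[OF U] by auto
    moreover have "Ck_on n U (Suc k) f" for k using smooth_near by blast
    ultimately show ?case using has_partials_on_near[OF U] by auto
  qed
next
  show "smooth_fun_on n (Kn n) (\<lambda>v. c * v i ^ m)" for n i m and c :: real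
    by (simp add: smooth_fun_on_real_def Ck_on_monomial)
qed

text \<open>
  By the Cauchy estimates, difference quotients in the \<open>j\<close>-th variable converge to the partial
  derivative uniformly, which is therefore holomorphic in the other variables as well.
\<close>

lemma holomorphic_cube_partial:
  fixes f :: "complex vec \<Rightarrow> complex"
  assumes \<delta>: "\<delta> > 0" and C: "\<And>v. v \<in> cube n \<delta> \<Longrightarrow> norm (f v) \<le> C"
    and diff: "\<And>v i. v \<in> cube n \<delta> \<Longrightarrow> i < n \<Longrightarrow> (\<lambda>t. f (v(i := t))) field_differentiable at (v i)"
    and j: "j < n"
  shows "\<exists>D. \<forall>v\<in>cube n (\<delta>/2). norm (partial j f v) \<le> D"
    and "v \<in> cube n (\<delta>/2) \<Longrightarrow> i < n \<Longrightarrow> (\<lambda>t. partial j f (v(i := t))) field_differentiable at (v i)"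
proof -
  have upd: "v(i := t) \<in> cube n \<epsilon>" if "v \<in> cube n \<epsilon>" "t \<in> ball 0 \<epsilon>" "i < n"
    for v :: "complex vec" and i t \<epsilon>
    using that by (auto simp: cube_def Kn_def)
  have half: "v \<in> cube n \<delta>" if "v \<in> cube n (\<delta>/2)" for v :: "complex vec"
    using that cube_mono[of "\<delta>/2" \<delta>] \<delta> by auto
  have hol: "(\<lambda>t. f (v(i := t))) holomorphic_on ball 0 \<delta>" if "v \<in> cube n \<delta>" "i < n" for v i
  proof (unfold holomorphic_on_def, intro ballI)
    fix t :: complex assume t: "t \<in> ball 0 \<delta>"
    have "(\<lambda>s. f ((v(i := t))(i := s))) field_differentiable at ((v(i := t)) i)"
      by (rule diff[OF upd[OF that(1) t that(2)] that(2)])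
    then show "(\<lambda>t. f (v(i := t))) field_differentiable at t within ball 0 \<delta>"
      by (simp only: fun_upd_upd fun_upd_same field_differentiable_at_within)
  qed
  have "C \<ge> 0" using C[of orig] \<delta> norm_ge_zero order_trans by (metis orig_in_cube)
  \<comment> \<open>A disc of radius \<open>\<delta>/8\<close> about a point of modulus below
    \<open>3/4 * \<delta>\<close> stays inside \<open>ball 0 \<delta>\<close>.\<close>
  define r where "r = \<delta>/8"
  have r: "r > 0" using \<delta> by (simp add: r_def)
  \<comment> \<open>Cauchy estimates, uniform in \<open>v\<close>. The constant \<open>C + 1\<close>
    instead of \<open>C\<close> places the values in an open ball.\<close>
  have bd: "norm ((deriv ^^ Suc m) (\<lambda>t. f (v(j := t))) z) \<le> fact (Suc m) * (C + 1) / r ^ Suc m"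
    if v: "v \<in> cube n \<delta>" and z: "norm z < 3/4 * \<delta>" for v z m
  proof (rule Cauchy_higher_deriv_bound[where y = 0])
    have sub: "cball z r \<subseteq> ball 0 \<delta>"
    proof
      fix w assume "w \<in> cball z r"
      then have "norm (w - z) \<le> r" by (simp add: dist_norm norm_minus_commute)
      then show "w \<in> ball 0 \<delta>"
        using norm_triangle_sub[of w z] z \<delta> by (simp add: r_def)
    qed
    show "(\<lambda>t. f (v(j := t))) holomorphic_on ball z r"
      by (rule holomorphic_on_subset[OF hol[OF v j]]) (use sub in auto)
    show "continuous_on (cball z r) (\<lambda>t. f (v(j := t)))"
      using holomorphic_on_imp_continuous_on[OF hol[OF v j]] sub by (rule continuous_on_subset)
    show "f (v(j := w)) \<in> ball 0 (C + 1)" if "w \<in> ball z r" for w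
    proof -
      have "w \<in> ball 0 \<delta>" using subsetD[OF sub, of w] that by simp
      then show ?thesis using C[OF upd[OF v _ j], of w] by simp
    qed
  qed (use r in auto)
  show "\<exists>D. \<forall>v\<in>cube n (\<delta>/2). norm (partial j f v) \<le> D"
  proof (intro exI ballI)
    fix v :: "complex vec" assume v: "v \<in> cube n (\<delta>/2)"
    then have "norm (v j) < 3/4 * \<delta>" using j \<delta> by (force simp: cube_def)
    from bd[OF half[OF v] this, of 0]
    show "norm (partial j f v) \<le> (C + 1) / r" by (simp add: partial_def)
  qed
  \<comment> \<open>This is the bound \<open>bd\<close> for second derivatives; it controls the
    Taylor remainder in a difference quotient.\<close>
  define M where "M = 2 * (C + 1) / r\<^sup>2"
  have M: "M \<ge> 0" using \<open>C \<ge> 0\<close> by (simp add: M_def)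
  have dq: "norm ((f (v(j := v j + h)) - f v) / h - partial j f v) \<le> M * norm h"
    if v: "v \<in> cube n (\<delta>/2)" and h: "h \<noteq> 0" "norm h < \<delta>/4" for v h
  proof -
    define F where "F t = f (v(j := t))" for t
    have F: "F holomorphic_on ball 0 \<delta>" unfolding F_def using hol[OF half[OF v] j] .
    have vj: "norm (v j) < \<delta>/2" using v j by (auto simp: cube_def)
    have near: "norm s < 3/4 * \<delta>" if "s \<in> ball (v j) (\<delta>/4)" for s
      using that vj norm_triangle_sub[of s "v j"] by (simp add: dist_norm norm_minus_commute)
    have "cmod ((deriv ^^ 0) F (v j + h) - (\<Sum>i\<le>1. (deriv ^^ i) F (v j) * ((v j + h) - v j) ^ i / fact i))
        \<le> M * cmod ((v j + h) - v j) ^ Suc 1 / fact 1"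
    proof (rule complex_Taylor[where S = "ball (v j) (\<delta>/4)" and f = "\<lambda>m. (deriv ^^ m) F"])
      fix i :: nat and s assume s: "s \<in> ball (v j) (\<delta>/4)"
      have "s \<in> ball 0 \<delta>" using near[OF s] \<delta> by simp
      then show "((deriv ^^ i) F has_field_derivative (deriv ^^ Suc i) F s) (at s within ball (v j) (\<delta>/4))"
        using holomorphic_derivI[OF holomorphic_higher_deriv[OF F open_ball, of i] open_ball] by simp
      next
      fix s assume s: "s \<in> ball (v j) (\<delta>/4)"
      show "cmod ((deriv ^^ Suc 1) F s) \<le> M"
        using bd[OF half[OF v] near[OF s], of 1] unfolding F_def M_def
        by (simp add: power2_eq_square)
    qed (use h \<delta> in \<open>auto simp: dist_norm\<close>)
    then have T: "cmod (F (v j + h) - F (v j) - deriv F (v j) * h) \<le> M * (norm h)\<^sup>2"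
      by (simp add: power2_eq_square algebra_simps)
    have "(f (v(j := v j + h)) - f v) / h - partial j f v
        = (F (v j + h) - F (v j) - deriv F (v j) * h) / h"
      using h(1) by (simp add: F_def[abs_def] partial_def diff_divide_distrib)
    also have "norm \<dots> \<le> M * (norm h)\<^sup>2 / norm h"
      unfolding norm_divide by (intro divide_right_mono T) simp
    also have "\<dots> = M * norm h" using h(1) by (simp add: power2_eq_square)
    finally show ?thesis .
  qed
  show "(\<lambda>t. partial j f (v(i := t))) field_differentiable at (v i)"
    if v: "v \<in> cube n (\<delta>/2)" and i: "i < n" for v i
  proof (cases "i = j")
    case True
    have "(\<lambda>t. deriv (\<lambda>s. f (v(j := s))) t) holomorphic_on ball 0 \<delta>"
      by (intro holomorphic_deriv hol half v j open_ball)
    moreover have "v j \<in> ball 0 \<delta>" using half[OF v] j by (auto simp: cube_def)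
    ultimately have "(\<lambda>t. deriv (\<lambda>s. f (v(j := s))) t) field_differentiable at (v j)"
      using holomorphic_on_imp_differentiable_at[OF _ open_ball] by blast
    then show ?thesis using True by (simp add: partial_def del: fun_upd_apply add: fun_upd_same)
  next
    case False
    \<comment> \<open>Nonzero increments tending to 0, all below the \<open>\<delta>/4\<close>
      demanded by \<open>dq\<close>.\<close>
    define h :: "nat \<Rightarrow> complex" where "h m = of_real (\<delta> / (8 * real (Suc m)))" for m
    have hn: "norm (h m) = \<delta> / (8 * real (Suc m))" for m
      unfolding h_def norm_of_real using \<delta> by simp
    have "norm (h m) > 0" for m unfolding hn using \<delta> by simp
    then have h0: "h m \<noteq> 0" for m by simp
    have hb: "norm (h m) < \<delta>/4" for m
    proof -
      have "8 * real (Suc m) > 4" by simp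
      then show ?thesis unfolding hn using \<delta> by (intro divide_strict_left_mono) auto
    qed
    define w where "w t m = (f ((v(i := t))(j := v j + h m)) - f (v(i := t))) / h m" for t m
    have "(\<lambda>t. partial j f (v(i := t))) holomorphic_on ball 0 (\<delta>/2)"
    proof (rule holomorphic_uniform_sequence[where f = "\<lambda>m t. w t m"])
      fix m
      have "norm (v j) < \<delta>/2" using v j by (auto simp: cube_def)
      then have "norm (v j + h m) < \<delta>"
        using norm_triangle_ineq[of "v j" "h m"] hb[of m] \<delta> by linarith
      then have "v(j := v j + h m) \<in> cube n \<delta>" by (intro upd half v j) simp
      then have "(\<lambda>t. f ((v(j := v j + h m))(i := t))) holomorphic_on ball 0 (\<delta>/2)"
        by (rule holomorphic_on_subset[OF hol[OF _ i]]) (use \<delta> in auto)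
      moreover have "(\<lambda>t. f (v(i := t))) holomorphic_on ball 0 (\<delta>/2)"
        by (rule holomorphic_on_subset[OF hol[OF half[OF v] i]]) (use \<delta> in auto)
      ultimately show "(\<lambda>t. w t m) holomorphic_on ball 0 (\<delta>/2)"
        unfolding w_def fun_upd_twist[OF False] using h0 by (intro holomorphic_intros) auto
    next
      have unif: "uniform_limit (ball 0 (\<delta>/2)) (\<lambda>m t. w t m) (\<lambda>t. partial j f (v(i := t))) sequentially"
      proof (rule uniform_limitI)
        fix e :: real assume "e > 0"
        have "(\<lambda>m. M * norm (h m)) \<longlonglongrightarrow> M * 0"
          unfolding hn by (intro tendsto_intros) real_asymp
        then have "\<forall>\<^sub>F m in sequentially. M * norm (h m) < e"
          using \<open>e > 0\<close> by (auto dest: order_tendstoD(2))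
        then show "\<forall>\<^sub>F m in sequentially. \<forall>t\<in>ball 0 (\<delta>/2). dist (w t m) (partial j f (v(i := t))) < e"
        proof eventually_elim
          case (elim m)
          show ?case
          proof
            fix t :: complex assume "t \<in> ball 0 (\<delta>/2)"
            from dq[OF upd[OF v this i] h0[of m] hb[of m]] elim False
            show "dist (w t m) (partial j f (v(i := t))) < e"
              by (simp add: w_def dist_norm)
          qed
        qed
      qed
      show "\<exists>d>0. cball x d \<subseteq> ball 0 (\<delta>/2) \<and> uniform_limit (cball x d) (\<lambda>m t. w t m)
          (\<lambda>t. partial j f (v(i := t))) sequentially" if "x \<in> ball 0 (\<delta>/2)" for x
        using open_contains_cball[of "ball 0 (\<delta>/2)"] that uniform_limit_on_subset[OF unif] by blast
    qed simp
    moreover have "v i \<in> ball 0 (\<delta>/2)" using v i by (auto simp: cube_def)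
    ultimately show ?thesis
      using holomorphic_on_imp_differentiable_at[OF _ open_ball] by blast
  qed
qed

interpretation complex: tame_scalar "TYPE(complex)"
proof
  fix n U and f :: "complex vec \<Rightarrow> complex"
  assume U: "nbhd0 n U" and f: "smooth_fun_on n U f"
  obtain C where C: "\<forall>\<^sub>F v in nb n. norm (f v) \<le> C"
    using continuous_on_bounded_near[OF U] f by (auto simp: smooth_fun_on_complex_def)
  have "\<forall>\<^sub>F v in nb n. \<forall>i<n. (\<lambda>t. f (v(i := t))) field_differentiable at (v i)"
    using has_partials_on_near[OF U] f by (auto simp: smooth_fun_on_complex_def)
  with C have "\<forall>\<^sub>F v in nb n. norm (f v) \<le> C \<and>
      (\<forall>i<n. (\<lambda>t. f (v(i := t))) field_differentiable at (v i))"
    by eventually_elim auto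
  \<comment> \<open>The coinduction invariant: boundedness and differentiability in each variable on
    some cube. Each partial derivative satisfies it on the cube of half the size.\<close>
  then have "\<exists>\<delta> C. \<delta> > 0 \<and> (\<forall>v\<in>cube n \<delta>. norm (f v) \<le> C \<and>
      (\<forall>i<n. (\<lambda>t. f (v(i := t))) field_differentiable at (v i)))"
    unfolding eventually_nb by blast
  then show "smooth_near n f"
  proof (coinduction arbitrary: f)
    case smooth_near
    then obtain \<delta> C where \<delta>: "\<delta> > 0" "\<And>v. v \<in> cube n \<delta> \<Longrightarrow> norm (f v) \<le> C"
      "\<And>v i. v \<in> cube n \<delta> \<Longrightarrow> i < n \<Longrightarrow> (\<lambda>t. f (v(i := t))) field_differentiable at (v i)"
      by blast
    have "\<exists>\<delta> C. \<delta> > 0 \<and> (\<forall>v\<in>cube n \<delta>. norm (partial j f v) \<le> C \<and>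
      (\<forall>i<n. (\<lambda>t. partial j f (v(i := t))) field_differentiable at (v i)))" if j: "j < n" for j
    proof -
      obtain D where "\<forall>v\<in>cube n (\<delta>/2). norm (partial j f v) \<le> D"
        using holomorphic_cube_partial(1)[of \<delta> n f, OF \<delta> j] by blast
      then show ?thesis
        using \<delta>(1) holomorphic_cube_partial(2)[of \<delta> n f, OF \<delta> j] half_gt_zero by blast
    qed
    moreover have "\<forall>\<^sub>F v in nb n. norm (f v) \<le> C"
      "\<forall>\<^sub>F v in nb n. \<forall>i<n. (\<lambda>t. f (v(i := t))) field_differentiable at (v i)"
      unfolding eventually_nb using \<delta> by blast+
    ultimately show ?case
      by (intro exI[of _ f] exI[of _ C] conjI) simp_all
  qed
next
  show "smooth_fun_on n (Kn n) (\<lambda>v. c * v i ^ m)" for n i m and c :: complex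
    by (simp add: smooth_fun_on_complex_def continuous_on_monomial has_partials_on_monomial)
qed

section \<open>Three-jets of functions of one variable\<close>

text \<open>The \<open>c\<close>s are Taylor coefficients, factorials included. Stating the jet as a
  congruence modulo O(t^4) lets sums, products and composites be treated by estimates alone.\<close>

definition jet4 :: "('k::real_normed_field \<Rightarrow> 'k) \<Rightarrow> 'k \<Rightarrow> 'k \<Rightarrow> 'k \<Rightarrow> 'k \<Rightarrow> bool" where
  "jet4 f c0 c1 c2 c3 \<longleftrightarrow>
     (\<lambda>t. f t - (c0 + c1 * t + c2 * t\<^sup>2 + c3 * t ^ 3)) \<in> O[at 0](\<lambda>t. t ^ 4)"

lemma jet4_cong:
  assumes "jet4 f c0 c1 c2 c3" "\<forall>\<^sub>F t in at 0. f t = g t"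
  shows "jet4 g c0 c1 c2 c3"
proof -
  have "(\<lambda>t. f t - (c0 + c1 * t + c2 * t\<^sup>2 + c3 * t ^ 3)) \<in> O[at 0](\<lambda>t. t ^ 4) \<longleftrightarrow>
        (\<lambda>t. g t - (c0 + c1 * t + c2 * t\<^sup>2 + c3 * t ^ 3)) \<in> O[at 0](\<lambda>t. t ^ 4)"
    by (rule landau_o.big.in_cong) (use assms(2) in \<open>auto elim: eventually_mono\<close>)
  with assms(1) show ?thesis by (simp add: jet4_def)
qed

lemma jet4_unique:
  assumes "jet4 f c0 c1 c2 c3" "jet4 g d0 d1 d2 d3" "\<forall>\<^sub>F t in at 0. f t = g t"
  shows "c0 = d0" "c1 = d1" "c2 = d2" "c3 = d3"
proof -
  have "jet4 g c0 c1 c2 c3" using jet4_cong assms by blast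
  from sum_in_bigo(2)[OF assms(2)[unfolded jet4_def] this[unfolded jet4_def]]
  have "(\<lambda>t. (g t - (d0 + d1 * t + d2 * t\<^sup>2 + d3 * t ^ 3)) - (g t - (c0 + c1 * t + c2 * t\<^sup>2 + c3 * t ^ 3)))
      \<in> O[at 0](\<lambda>t. t ^ 4)" .
  then have "(\<lambda>t. (c0 - d0) + (c1 - d1) * t + (c2 - d2) * t\<^sup>2 + (c3 - d3) * t ^ 3) \<in> O[at 0](\<lambda>t. t ^ 4)"
    by (simp add: algebra_simps)
  from poly_coeff_eq_0_if_bigo[OF this]
  show "c0 = d0" "c1 = d1" "c2 = d2" "c3 = d3" by auto
qed

lemma jet4_add:
  assumes "jet4 f c0 c1 c2 c3" "jet4 g d0 d1 d2 d3"
  shows "jet4 (\<lambda>t. f t + g t) (c0 + d0) (c1 + d1) (c2 + d2) (c3 + d3)"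
proof -
  have "(\<lambda>t. (f t - (c0 + c1 * t + c2 * t\<^sup>2 + c3 * t ^ 3)) + (g t - (d0 + d1 * t + d2 * t\<^sup>2 + d3 * t ^ 3)))
      \<in> O[at 0](\<lambda>t. t ^ 4)"
    by (rule sum_in_bigo(1)[OF assms[unfolded jet4_def]])
  then show ?thesis unfolding jet4_def by (simp add: algebra_simps)
qed

lemma bigo_power_at_0:
  assumes "n \<le> m"
  shows "(\<lambda>t. t ^ m) \<in> O[at (0::'k::real_normed_field)](\<lambda>t. t ^ n)"
proof (rule bigoI[of _ 1])
  have "\<forall>\<^sub>F t in at (0::'k). t \<in> ball 0 1" by (intro eventually_at_in_open') auto
  then show "\<forall>\<^sub>F t in at (0::'k). norm (t ^ m) \<le> 1 * norm (t ^ n)"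
    by eventually_elim (use assms in \<open>auto simp: norm_power intro!: power_decreasing\<close>)
qed

lemma jet4_mult:
  fixes f :: "'k::real_normed_field \<Rightarrow> 'k"
  assumes f: "jet4 f c0 c1 c2 c3" and g: "jet4 g d0 d1 d2 d3"
  shows "jet4 (\<lambda>t. f t * g t) (c0 * d0) (c0 * d1 + c1 * d0) (c0 * d2 + c1 * d1 + c2 * d0)
           (c0 * d3 + c1 * d2 + c2 * d1 + c3 * d0)"
proof -
  define P where "P t = c0 + c1 * t + c2 * t\<^sup>2 + c3 * t ^ 3" for t
  define Q where "Q t = d0 + d1 * t + d2 * t\<^sup>2 + d3 * t ^ 3" for t
  have one: "h \<in> O[at 0](\<lambda>_. 1)" if "isCont h 0" for h :: "'k \<Rightarrow> 'k"
    by (rule bigoI_tendsto[where c = "h 0"]) (use that in \<open>auto simp: isCont_def\<close>)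
  have P: "P \<in> O[at 0](\<lambda>_. 1)" unfolding P_def by (intro one continuous_intros)
  have Q: "Q \<in> O[at 0](\<lambda>_. 1)" unfolding Q_def by (intro one continuous_intros)
  have fP: "(\<lambda>t. f t - P t) \<in> O[at 0](\<lambda>t. t ^ 4)" using f by (simp add: jet4_def P_def)
  have gQ: "(\<lambda>t. g t - Q t) \<in> O[at 0](\<lambda>t. t ^ 4)" using g by (simp add: jet4_def Q_def)
  have "(\<lambda>t. (f t - P t) + P t) \<in> O[at 0](\<lambda>_. 1)"
    by (rule sum_in_bigo(1)[OF _ P]) (use landau_o.big_trans[OF fP bigo_power_at_0[of 0 4]] in simp)
  then have f1: "f \<in> O[at 0](\<lambda>_. 1)" by simp
  \<comment> \<open>The terms of order 4 to 6 in \<open>P t * Q t\<close>, divided by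
    \<open>t ^ 4\<close>.\<close>
  define R where "R t = (c1 * d3 + c2 * d2 + c3 * d1) + (c2 * d3 + c3 * d2) * t + c3 * d3 * t\<^sup>2" for t
  have R: "(\<lambda>t. t ^ 4 * R t) \<in> O[at 0](\<lambda>t. t ^ 4 * 1)"
    unfolding R_def by (intro landau_o.big.mult landau_o.big_refl one continuous_intros)
  have "(\<lambda>t. f t * (g t - Q t) + (f t - P t) * Q t + t ^ 4 * R t) \<in> O[at 0](\<lambda>t. t ^ 4)"
    using landau_o.big.mult[OF f1 gQ] landau_o.big.mult[OF fP Q] R
    by (intro sum_in_bigo) auto
  also have "(\<lambda>t. f t * (g t - Q t) + (f t - P t) * Q t + t ^ 4 * R t) =
     (\<lambda>t. f t * g t - (c0 * d0 + (c0 * d1 + c1 * d0) * t + (c0 * d2 + c1 * d1 + c2 * d0) * t\<^sup>2 +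
           (c0 * d3 + c1 * d2 + c2 * d1 + c3 * d0) * t ^ 3))"
    unfolding P_def Q_def R_def fun_eq_iff by algebra
  finally show ?thesis unfolding jet4_def .
qed

lemma jet4_cmult:
  assumes "jet4 f c0 c1 c2 c3"
  shows "jet4 (\<lambda>t. a * f t) (a * c0) (a * c1) (a * c2) (a * c3)"
proof -
  have "jet4 (\<lambda>t. a) a 0 0 0" by (simp add: jet4_def)
  from jet4_mult[OF this assms] show ?thesis by simp
qed

lemma jet4_axis:
  assumes "smooth_near n f" "i < n"
  shows "jet4 (\<lambda>t. f (orig(i := t))) (f orig) (partial i f orig)
    (partial i (partial i f) orig / 2) (partial i (partial i (partial i f)) orig / 6)"
  using smooth_near_Taylor[OF assms, of 3]
  by (simp add: jet4_def eval_nat_numeral atMost_Suc add_ac mult_ac)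

text \<open>The inner components are O(t^2), so everything beyond the linear part of
  \<open>f\<close> is O(t^4).\<close>

lemma jet4_compose:
  assumes f: "smooth_near n f" and Kn: "\<And>t. h t \<in> Kn n"
    and h: "\<And>i. i < n \<Longrightarrow> jet4 (\<lambda>t. h t i) 0 0 (a i) (b i)"
  shows "jet4 (\<lambda>t. f (h t)) (f orig) 0 (\<Sum>i<n. partial i f orig * a i) (\<Sum>i<n. partial i f orig * b i)"
proof -
  have O2: "(\<lambda>t. h t i) \<in> O[at 0](\<lambda>t. t\<^sup>2)" if "i < n" for i
  proof -
    have "(\<lambda>t. (h t i - (0 + 0 * t + a i * t\<^sup>2 + b i * t ^ 3)) + (a i * t\<^sup>2 + b i * t ^ 3)) \<in> O[at 0](\<lambda>t. t\<^sup>2)"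
    proof (rule sum_in_bigo(1))
      show "(\<lambda>t. h t i - (0 + 0 * t + a i * t\<^sup>2 + b i * t ^ 3)) \<in> O[at 0](\<lambda>t. t\<^sup>2)"
        using landau_o.big_trans[OF h[OF that, unfolded jet4_def] bigo_power_at_0[of 2 4]] by simp
      show "(\<lambda>t. a i * t\<^sup>2 + b i * t ^ 3) \<in> O[at 0](\<lambda>t. t\<^sup>2)"
        using bigo_power_at_0[of 2 3] by (intro sum_in_bigo) auto
    qed
    then show ?thesis by simp
  qed
  have "((\<lambda>t. h t i) \<longlongrightarrow> 0) (at 0)" if i: "i < n" for i
  proof -
    obtain C where C: "\<forall>\<^sub>F t in at 0. norm (h t i) \<le> C * norm (t\<^sup>2)"
      using landau_o.bigE[OF O2[OF i]] by blast
    have "((\<lambda>t::'a. C * norm (t\<^sup>2)) \<longlongrightarrow> C * norm (0\<^sup>2 :: 'a)) (at 0)"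
      by (intro tendsto_intros)
    with C show ?thesis by (intro Lim_null_comparison[OF C]) auto
  qed
  then have "filterlim h (nb n) (at 0)"
    using Kn by (simp add: filterlim_nb_iff)
  from smooth_near_first_order[OF f this O2]
  have "(\<lambda>t. f (h t) - f orig - (\<Sum>i<n. partial i f orig * h t i)) \<in> O[at 0](\<lambda>t. (t\<^sup>2)\<^sup>2)" .
  then have "(\<lambda>t. f (h t) - f orig - (\<Sum>i<n. partial i f orig * h t i)) \<in> O[at 0](\<lambda>t. t ^ 4)"
    by (simp flip: power_mult)
  moreover have "(\<lambda>t. \<Sum>i<n. partial i f orig * (h t i - (a i * t\<^sup>2 + b i * t ^ 3))) \<in> O[at 0](\<lambda>t. t ^ 4)"
    using h by (intro big_sum_in_bigo) (auto simp: jet4_def)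
  ultimately have "(\<lambda>t. (f (h t) - f orig - (\<Sum>i<n. partial i f orig * h t i)) +
      (\<Sum>i<n. partial i f orig * (h t i - (a i * t\<^sup>2 + b i * t ^ 3)))) \<in> O[at 0](\<lambda>t. t ^ 4)"
    by (rule sum_in_bigo)
  also have "(\<lambda>t. (f (h t) - f orig - (\<Sum>i<n. partial i f orig * h t i)) +
      (\<Sum>i<n. partial i f orig * (h t i - (a i * t\<^sup>2 + b i * t ^ 3)))) =
     (\<lambda>t. f (h t) - (f orig + 0 * t + (\<Sum>i<n. partial i f orig * a i) * t\<^sup>2 +
        (\<Sum>i<n. partial i f orig * b i) * t ^ 3))"
    by (simp add: fun_eq_iff ring_distribs sum.distrib sum_subtractf sum_distrib_right mult.assoc)
  finally show ?thesis unfolding jet4_def .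
qed

section \<open>First derivatives at the origin\<close>

lemma DERIV_axis:
  assumes "smooth_near n f" "i < n"
  shows "((\<lambda>t. f (orig(i := t))) has_field_derivative partial i f orig) (at 0)"
  using eventually_nb_orig[OF smooth_near_DERIV[OF assms]] .

lemma DERIV_chain_orig:
  fixes f :: "('k::real_normed_field) vec \<Rightarrow> 'k"
  assumes "smooth_near n f" "\<gamma> 0 = orig" "\<forall>\<^sub>F t in nhds 0. \<gamma> t \<in> Kn n"
    "\<And>i. i < n \<Longrightarrow> ((\<lambda>t. \<gamma> t i) has_field_derivative \<gamma>' i) (at 0)"
  shows "((\<lambda>t. f (\<gamma> t)) has_field_derivative (\<Sum>i<n. partial i f orig * \<gamma>' i)) (at 0)"
  using eventually_nb_orig[OF smooth_near_chain[OF assms(1)]] assms(2-) by blast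

lemma DERIV_eventually_unique:
  assumes "(f has_field_derivative a) (at x)" "(g has_field_derivative b) (at x)"
    "\<forall>\<^sub>F t in nhds x. f t = g t"
  shows "a = b"
  using assms DERIV_cong_ev[OF refl assms(3) refl] DERIV_unique by metis

context tame_scalar
begin

lemma smooth_germ_near:
  fixes f :: "'k vec \<Rightarrow> 'k vec"
  assumes "smooth_germ n p f"
  shows "\<forall>\<^sub>F v in nb n. f v \<in> Kn p" "\<And>j. j < p \<Longrightarrow> smooth_near n (\<lambda>v. f v j)"
proof -
  obtain U where U: "nbhd0 n U" "f ` U \<subseteq> Kn p" "\<And>j. j < p \<Longrightarrow> smooth_fun_on n U (\<lambda>x. f x j)"
    using assms by (auto simp: smooth_germ_def)
  show "\<forall>\<^sub>F v in nb n. f v \<in> Kn p"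
    using nbhd0_eventually[OF U(1)] by eventually_elim (use U(2) in auto)
  show "smooth_near n (\<lambda>v. f v j)" if "j < p" for j
    using smooth_fun_on_near[OF U(1) U(3)[OF that]] .
qed

lemma map_germ_filterlim:
  fixes f :: "'k vec \<Rightarrow> 'k vec"
  assumes "map_germ n p f"
  shows "filterlim f (nb p) (nb n)"
proof -
  have f: "smooth_germ n p f" "f orig = orig" using assms by (auto simp: map_germ_def)
  have "((\<lambda>v. f v j) \<longlongrightarrow> 0) (nb n)" if "j < p" for j
    using smooth_near_tendsto[OF smooth_germ_near(2)[OF f(1) that] filterlim_ident] f(2) by simp
  then show ?thesis using smooth_germ_near(1)[OF f(1)] by (simp add: filterlim_nb_iff)
qed

text \<open>Differentiating \<open>\<theta> \<circ> \<phi> = id\<close> along the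
  \<open>j\<close>-th axis gives the entries of the product of the two Jacobian matrices.\<close>

lemma inverse_germ_partials:
  fixes \<theta> \<phi> :: "'k vec \<Rightarrow> 'k vec"
  assumes \<theta>: "map_germ n n \<theta>" and \<phi>: "map_germ n n \<phi>" and inv: "germ_eq n (\<theta> \<circ> \<phi>) id"
    and ij: "i < n" "j < n"
  shows "(\<Sum>k<n. partial k (\<lambda>v. \<theta> v i) orig * partial j (\<lambda>v. \<phi> v k) orig) = (if i = j then 1 else 0)"
proof (rule DERIV_eventually_unique)
  have sm: "smooth_germ n n \<theta>" "smooth_germ n n \<phi>" and 0: "\<phi> orig = orig"
    using \<theta> \<phi> by (auto simp: map_germ_def)
  note ax = filterlim_axis[OF ij(2), where 'k = 'k]
  show "((\<lambda>t. \<theta> (\<phi> (orig(j := t))) i) has_field_derivative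
      (\<Sum>k<n. partial k (\<lambda>v. \<theta> v i) orig * partial j (\<lambda>v. \<phi> v k) orig)) (at 0)"
  proof (rule DERIV_chain_orig[OF smooth_germ_near(2)[OF sm(1) ij(1)]])
    show "\<phi> (orig(j := 0)) = orig" using 0 by (simp add: fun_upd_idem)
    show "\<forall>\<^sub>F t in nhds 0. \<phi> (orig(j := t)) \<in> Kn n"
      using eventually_compose_filterlim[OF smooth_germ_near(1)[OF sm(2)] ax] .
    show "((\<lambda>t. \<phi> (orig(j := t)) k) has_field_derivative partial j (\<lambda>v. \<phi> v k) orig) (at 0)" if "k < n" for k
      using DERIV_axis[OF smooth_germ_near(2)[OF sm(2) that] ij(2)] .
  qed
  show "((\<lambda>t. (orig(j := t)) i) has_field_derivative (if i = j then 1 else 0)) (at (0::'k))"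
    by (cases "i = j") simp_all
  show "\<forall>\<^sub>F t in nhds 0. \<theta> (\<phi> (orig(j := t))) i = (orig(j := t)) i"
    using eventually_compose_filterlim[OF germ_eq_eventually[OF inv] ax]
    by eventually_elim simp
qed

end

section \<open>Stable one-parameter unfoldings\<close>

lemma sum_lessThan_2: "(\<Sum>i<2. f i) = f 0 + f (1::nat)"
  by (simp add: eval_nat_numeral)

lemma sum_lessThan_3: "(\<Sum>i<3. f i) = f 0 + f 1 + f (2::nat)"
  by (simp add: eval_nat_numeral)

lemma eventually_axis:
  fixes P :: "('k::real_normed_field) vec \<Rightarrow> bool"
  assumes "eventually P (nb n)" "i < n"
  shows "\<forall>\<^sub>F t in at 0. P (orig(i := t))"
  using eventually_compose_filterlim[OF assms(1) filterlim_axis[OF assms(2)]]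
  by (auto simp: eventually_at_filter elim: eventually_mono)

lemma jet4_eqI:
  "jet4 f c0 c1 c2 c3 \<Longrightarrow> c1 = d1 \<Longrightarrow> c2 = d2 \<Longrightarrow> jet4 f c0 d1 d2 c3"
  by simp

context tame_scalar
begin

text \<open>
  Solve the stability equation for the vector fields \<open>t\<^sup>m (s\<^sub>0, s\<^sub>1, 0)\<close> with \<open>\<alpha> s\<^sub>0 + \<beta> s\<^sub>1 = 1\<close> and \<open>m = 1, 2\<close>,
  and apply \<open>(\<alpha>, \<beta>)\<close> along the axis \<open>\<lambda> = 0\<close>.
\<close>

lemma stable_unfolding_coefficients:
  fixes F :: "'k vec \<Rightarrow> 'k vec" and a b k :: "nat \<Rightarrow> 'k"
  assumes stable: "stable_germ 2 3 F"
    and last: "\<forall>\<^sub>F v in nb 2. F v 2 = v 1"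
    and crit: "\<And>j. j < 2 \<Longrightarrow> partial 0 (\<lambda>v. F v j) orig = 0"
    and a: "\<And>j. a j = partial 0 (partial 0 (\<lambda>v. F v j)) orig / 2"
    and b: "\<And>j. b j = partial 0 (partial 0 (partial 0 (\<lambda>v. F v j))) orig / 6"
    and k: "\<And>j. k j = partial 0 (partial 1 (\<lambda>v. F v j)) orig"
    and \<alpha>: "\<alpha> \<noteq> 0 \<or> \<beta> \<noteq> 0" "\<alpha> * a 0 + \<beta> * a 1 = 0" "\<alpha> * b 0 + \<beta> * b 1 = 0"
  shows "\<alpha> * k 0 + \<beta> * k 1 \<noteq> 0" "a 0 \<noteq> 0 \<or> a 1 \<noteq> 0"
proof -
  have F: "smooth_germ 2 3 F" "F orig = orig" and
    solve: "\<And>\<zeta>. smooth_germ 2 3 \<zeta> \<Longrightarrow> \<exists>\<xi> \<eta>. smooth_germ 2 2 \<xi> \<and> smooth_germ 3 3 \<eta> \<and>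
           germ_eq 2 \<zeta> (\<lambda>x j. dmap 2 3 F \<xi> x j + \<eta> (F x) j)"
    using stable by (auto simp: stable_germ_def map_germ_def)
  have smF: "smooth_near 2 (\<lambda>v. F v j)" if "j < 2" for j
    using smooth_germ_near(2)[OF F(1)] that by simp
  define e :: "'k \<Rightarrow> 'k vec" where "e t = orig(0 := t)" for t
  \<comment> \<open>Near 0 this equals \<open>F (e t)\<close>, but it lies in \<open>Kn 3\<close>
    for every \<open>t\<close>, as \<open>jet4_compose\<close> requires.\<close>
  define h :: "'k \<Rightarrow> 'k vec" where "h t = orig(0 := F (e t) 0, 1 := F (e t) 1)" for t
  have ax: "\<forall>\<^sub>F t in at 0. P (e t)" if "eventually P (nb 2)" for P
    unfolding e_def by (rule eventually_axis[OF that]) simp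
  have hKn: "h t \<in> Kn 3" for t by (auto simp: h_def Kn_def)
  have jF: "jet4 (\<lambda>t. F (e t) j) 0 0 (a j) (b j)" if "j < 2" for j
    using jet4_axis[OF smF[OF that], of 0] F(2) crit[OF that] by (simp add: e_def a b)
  have jD: "\<exists>d. jet4 (\<lambda>t. partial 0 (\<lambda>v. F v j) (e t)) 0 (2 * a j) (3 * b j) d" if "j < 2" for j
    using jet4_axis[OF smooth_near_partial[OF smF[OF that]], of 0 0] crit[OF that]
    by (auto simp: e_def a b)
  have jK: "\<exists>k0 k2 k3. jet4 (\<lambda>t. partial 1 (\<lambda>v. F v j) (e t)) k0 (k j) k2 k3" if "j < 2" for j
    using jet4_axis[OF smooth_near_partial[OF smF[OF that]], of 1 0] by (auto simp: e_def k)
  have jh: "jet4 (\<lambda>t. h t j) 0 0 (if j < 2 then a j else 0) (if j < 2 then b j else 0)" if j: "j < 3" for j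
  proof -
    consider "j = 0" | "j = 1" | "j = 2" using j by linarith
    then show ?thesis
      using jF[of 0] jF[of 1] by cases (auto simp: h_def jet4_def)
  qed
  obtain s :: "nat \<Rightarrow> 'k" where s: "\<alpha> * s 0 + \<beta> * s 1 = 1"
  proof (cases "\<alpha> = 0")
    case True
    then show ?thesis using \<alpha>(1) that[of "\<lambda>j. if j = 0 then 0 else 1 / \<beta>"] by simp
  next
    case False
    then show ?thesis using that[of "\<lambda>j. if j = 0 then 1 / \<alpha> else 0"] by simp
  qed
  \<comment> \<open>The weights kill \<open>a\<close> and \<open>b\<close>, so the factor of
    \<open>\<xi> (e t) 0\<close> is O(t^3) and does not reach orders 1 and 2. Here
    \<open>\<epsilon>\<close> is the last component of \<open>\<eta>\<close> at the origin,
    \<open>E0\<close> and \<open>E1\<close> are first partial derivatives of that component,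
    \<open>H0\<close> and \<open>H1\<close> come from the other two, and \<open>\<kappa>0\<close>,
    \<open>\<kappa>2\<close> from the weighted derivative of \<open>F\<close> in the
    parameter.\<close>
  have key: "\<exists>c0 c3 \<kappa>0 \<kappa>2 \<epsilon> E0 E1 H0 H1. 
      jet4 (\<lambda>t. t ^ m) c0 (- ((\<alpha> * k 0 + \<beta> * k 1) * \<epsilon>))
        (- (\<kappa>2 * \<epsilon> + \<kappa>0 * (E0 * a 0 + E1 * a 1)) + (H0 * a 0 + H1 * a 1)) c3" for m
  proof -
    define \<zeta> :: "'k vec \<Rightarrow> 'k vec" where "\<zeta> v = (\<lambda>j. (if j < 2 then s j else 0) * v 0 ^ m)" for v
    have "smooth_germ 2 3 \<zeta>"
      unfolding smooth_germ_def
    proof (intro exI[of _ "Kn 2"] conjI allI impI)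
      show "nbhd0 2 (Kn 2 :: 'k vec set)"
        by (auto simp: nbhd0_def Kn_def)
      show "\<zeta> ` Kn 2 \<subseteq> Kn 3" by (auto simp: \<zeta>_def Kn_def)
      show "smooth_fun_on 2 (Kn 2) (\<lambda>v. \<zeta> v j)" for j
        unfolding \<zeta>_def by (rule smooth_fun_on_monomial)
    qed
    then obtain \<xi> \<eta> where \<xi>: "smooth_germ 2 2 \<xi>" and \<eta>: "smooth_germ 3 3 \<eta>" and
      eq: "germ_eq 2 \<zeta> (\<lambda>x j. dmap 2 3 F \<xi> x j + \<eta> (F x) j)"
      using solve by blast
    have "\<forall>\<^sub>F t in at 0. F (e t) \<in> Kn 3" using ax[OF smooth_germ_near(1)[OF F(1)]] .
    moreover have "\<forall>\<^sub>F t in at 0. F (e t) 2 = 0"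
      using ax[OF last] by (simp add: e_def)
    ultimately have Fh: "\<forall>\<^sub>F t in at 0. F (e t) = h t"
    proof eventually_elim
      case (elim t)
      have "F (e t) i = h t i" for i
      proof -
        consider "i = 0" | "i = 1" | "i = 2" | "i \<ge> 3" by linarith
        then show ?thesis by cases (use elim in \<open>auto simp: h_def Kn_def\<close>)
      qed
      then show ?case by auto
    qed
    have p0: "\<forall>\<^sub>F t in at 0. partial 0 (\<lambda>v. F v 2) (e t) = 0"
      using ax[OF partial_eventually_cong[OF last, of 0]] by (simp add: partial_def)
    have p1: "\<forall>\<^sub>F t in at 0. partial 1 (\<lambda>v. F v 2) (e t) = 1"
      using ax[OF partial_eventually_cong[OF last, of 1]] by (simp add: partial_def)
    \<comment> \<open>Weighted sum of the first two components of the stability equation, with the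
      second component of \<open>\<xi>\<close> replaced by its value from the third.\<close>
    define T where "T t = (\<alpha> * partial 0 (\<lambda>v. F v 0) (e t) + \<beta> * partial 0 (\<lambda>v. F v 1) (e t)) * \<xi> (e t) 0
        + (- 1) * ((\<alpha> * partial 1 (\<lambda>v. F v 0) (e t) + \<beta> * partial 1 (\<lambda>v. F v 1) (e t)) * \<eta> (h t) 2)
        + (\<alpha> * \<eta> (h t) 0 + \<beta> * \<eta> (h t) 1)" for t
    have T: "\<forall>\<^sub>F t in at 0. T t = t ^ m"
      using ax[OF germ_eq_eventually[OF eq]] Fh p0 p1
    proof eventually_elim
      case (elim t)
      have *: "(if j < 2 then s j else 0) * t ^ m
          = partial 0 (\<lambda>v. F v j) (e t) * \<xi> (e t) 0 + partial 1 (\<lambda>v. F v j) (e t) * \<xi> (e t) 1 + \<eta> (h t) j"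
        if "j < 3" for j
        using fun_cong[OF elim(1), of j] that elim(2)
        by (simp add: \<zeta>_def dmap_def sum_lessThan_2 e_def del: One_nat_def)
      \<comment> \<open>In the third component the test field is 0 and the gradient of
        \<open>F\<close> is (0, 1).\<close>
      have "\<xi> (e t) 1 = - \<eta> (h t) 2"
        using *[of 2] elim(3,4) by (simp add: eq_neg_iff_add_eq_0)
      then have "s j * t ^ m = partial 0 (\<lambda>v. F v j) (e t) * \<xi> (e t) 0 -
          partial 1 (\<lambda>v. F v j) (e t) * \<eta> (h t) 2 + \<eta> (h t) j" if "j < 2" for j
        using *[of j] that by simp
      note s0 = this[of 0, simplified] and s1 = this[of 1, simplified]
      have "T t = \<alpha> * (s 0 * t ^ m) + \<beta> * (s 1 * t ^ m)"
        unfolding T_def One_nat_def s0 s1 by (simp add: ring_distribs mult_ac)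
      also have "\<dots> = (\<alpha> * s 0 + \<beta> * s 1) * t ^ m" by (simp add: algebra_simps)
      also have "\<dots> = t ^ m" by (simp only: s mult_1_left)
      finally show ?case .
    qed
    obtain d0 d1 where d: "jet4 (\<lambda>t. partial 0 (\<lambda>v. F v 0) (e t)) 0 (2 * a 0) (3 * b 0) d0"
      "jet4 (\<lambda>t. partial 0 (\<lambda>v. F v 1) (e t)) 0 (2 * a 1) (3 * b 1) d1"
      using jD[of 0] jD[of 1] by auto
    obtain k00 k02 k03 k10 k12 k13 where kk:
      "jet4 (\<lambda>t. partial 1 (\<lambda>v. F v 0) (e t)) k00 (k 0) k02 k03"
      "jet4 (\<lambda>t. partial 1 (\<lambda>v. F v 1) (e t)) k10 (k 1) k12 k13"
      using jK[of 0] jK[of 1] by auto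
    obtain x0 x1 x2 x3 where x: "jet4 (\<lambda>t. \<xi> (e t) 0) x0 x1 x2 x3"
      using jet4_axis[OF smooth_germ_near(2)[OF \<xi>, of 0], of 0] unfolding e_def by auto
    have y: "\<exists>y3. jet4 (\<lambda>t. \<eta> (h t) i) (\<eta> orig i) 0
        (partial 0 (\<lambda>v. \<eta> v i) orig * a 0 + partial 1 (\<lambda>v. \<eta> v i) orig * a 1) y3" if "i < 3" for i
      using jet4_compose[OF smooth_germ_near(2)[OF \<eta> that] hKn jh]
      by (auto simp: sum_lessThan_3 simp del: One_nat_def)
    obtain y0 y1 y2 where y:
      "jet4 (\<lambda>t. \<eta> (h t) 0) (\<eta> orig 0) 0
        (partial 0 (\<lambda>v. \<eta> v 0) orig * a 0 + partial 1 (\<lambda>v. \<eta> v 0) orig * a 1) y0"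
      "jet4 (\<lambda>t. \<eta> (h t) 1) (\<eta> orig 1) 0
        (partial 0 (\<lambda>v. \<eta> v 1) orig * a 0 + partial 1 (\<lambda>v. \<eta> v 1) orig * a 1) y1"
      "jet4 (\<lambda>t. \<eta> (h t) 2) (\<eta> orig 2) 0
        (partial 0 (\<lambda>v. \<eta> v 2) orig * a 0 + partial 1 (\<lambda>v. \<eta> v 2) orig * a 1) y2"
      using y[of 0] y[of 1] y[of 2] by auto
    have z: "\<alpha> * (2 * a 0) + \<beta> * (2 * a 1) = 0" "\<alpha> * (3 * b 0) + \<beta> * (3 * b 1) = 0"
      using \<alpha>(2,3) by algebra+
    note jT = jet4_cong[OF jet4_add[OF jet4_add[OF jet4_mult[OF jet4_add[OF jet4_cmult[OF d(1), of \<alpha>] jet4_cmult[OF d(2), of \<beta>]] x]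
      jet4_cmult[OF jet4_mult[OF jet4_add[OF jet4_cmult[OF kk(1), of \<alpha>] jet4_cmult[OF kk(2), of \<beta>]] y(3)], of "- 1"]]
      jet4_add[OF jet4_cmult[OF y(1), of \<alpha>] jet4_cmult[OF y(2), of \<beta>]]] T[unfolded T_def]]
    have "\<exists>c0 c3. jet4 (\<lambda>t. t ^ m) c0 (- ((\<alpha> * k 0 + \<beta> * k 1) * \<eta> orig 2))
        (- ((\<alpha> * k02 + \<beta> * k12) * \<eta> orig 2 + (\<alpha> * k00 + \<beta> * k10) *
            (partial 0 (\<lambda>v. \<eta> v 2) orig * a 0 + partial 1 (\<lambda>v. \<eta> v 2) orig * a 1)) +
          ((\<alpha> * partial 0 (\<lambda>v. \<eta> v 0) orig + \<beta> * partial 0 (\<lambda>v. \<eta> v 1) orig) * a 0 +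
           (\<alpha> * partial 1 (\<lambda>v. \<eta> v 0) orig + \<beta> * partial 1 (\<lambda>v. \<eta> v 1) orig) * a 1)) c3"
      by (rule exI, rule exI, rule jet4_eqI[OF jT]) (simp_all only: z mult_zero_left mult_zero_right add_0_left add_0_right,
            simp_all add: algebra_simps)
    then show ?thesis by (elim exE) (intro exI, assumption)
  qed
  show "\<alpha> * k 0 + \<beta> * k 1 \<noteq> 0"
  proof
    assume 0: "\<alpha> * k 0 + \<beta> * k 1 = 0"
    \<comment> \<open>The coefficient of \<open>t\<close> would have to be both 0 and 1.\<close>
    obtain c0 c2 c3 where "jet4 (\<lambda>t::'k. t ^ 1) c0 0 c2 c3" using key[of 1] unfolding 0 by auto
    moreover have "jet4 (\<lambda>t::'k. t ^ 1) 0 1 0 0" by (simp add: jet4_def)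
    ultimately have "(0::'k) = 1" by (rule jet4_unique(2)) simp
    then show False by simp
  qed
  then have 1: "\<alpha> * k 0 + \<beta> * k 1 \<noteq> 0" .
  show "a 0 \<noteq> 0 \<or> a 1 \<noteq> 0"
  proof (rule ccontr)
    assume "\<not> (a 0 \<noteq> 0 \<or> a 1 \<noteq> 0)"
    then have a0: "a 0 = 0" "a 1 = 0" by auto
    \<comment> \<open>With \<open>a = 0\<close> the coefficient of \<open>t\<close> forces
      \<open>\<epsilon> = 0\<close>, and then that of \<open>t^2\<close> cannot be 1.\<close>
    obtain c0 c3 \<kappa>2 \<epsilon> where
      "jet4 (\<lambda>t::'k. t ^ 2) c0 (- ((\<alpha> * k 0 + \<beta> * k 1) * \<epsilon>)) (- (\<kappa>2 * \<epsilon>)) c3"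
      using key[of 2] unfolding a0 by auto
    moreover have "jet4 (\<lambda>t::'k. t ^ 2) 0 0 1 0" by (simp add: jet4_def)
    ultimately have "- ((\<alpha> * k 0 + \<beta> * k 1) * \<epsilon>) = 0" "- (\<kappa>2 * \<epsilon>) = 1"
      using jet4_unique(2,3)[OF _ _ always_eventually] by blast+
    with 1 show False by auto
  qed
qed

end

section \<open>The germ C3\<close>

lemma filterlim_C3: "filterlim (C3 :: ('k::real_normed_field) vec \<Rightarrow> 'k vec) (nb 3) (nb 2)"
proof -
  have v: "((\<lambda>v::'k vec. v i) \<longlongrightarrow> 0) (nb 2)" if "i < 2" for i
    using filterlim_ident[of "nb 2 :: 'k vec filter"] that by (auto simp: filterlim_nb_iff)
  have "((\<lambda>v::'k vec. C3 v j) \<longlongrightarrow> 0) (nb 2)" if j: "j < 3" for j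
  proof -
    have t: "((\<lambda>v::'k vec. (v 1)\<^sup>2) \<longlongrightarrow> 0\<^sup>2) (nb 2)"
      "((\<lambda>v::'k vec. v 0 * v 1 ^ 3 + v 0 ^ 3 * v 1) \<longlongrightarrow> 0 * 0 ^ 3 + 0 ^ 3 * 0) (nb 2)"
      by (intro tendsto_intros v; simp)+
    consider "j = 0" | "j = 1" | "j = 2" using j by linarith
    then show ?thesis using v[of 0] t by cases (simp_all add: C3_def Let_def)
  qed
  moreover have "C3 v \<in> Kn 3" for v :: "'k vec" by (auto simp: C3_def Let_def Kn_def)
  ultimately show ?thesis by (simp add: filterlim_nb_iff)
qed

lemma C3_axis: "C3 (orig(1 := t)) = orig(1 := t\<^sup>2)"
  by (auto simp: C3_def Let_def)

context tame_scalar
begin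

text \<open>The equivalence is needed in both directions: the first identity compares kernels of
  differentials, the second compares jets. The second follows by substituting
  \<open>\<theta>\<close> into the first and applying \<open>\<tau>\<close>.\<close>

lemma A_equivalent_C3E:
  fixes A :: "'k vec \<Rightarrow> 'k vec"
  assumes "A_equivalent 2 3 C3 A"
  obtains \<phi> \<theta> \<psi> \<tau> where "map_germ 2 2 \<phi>" "map_germ 2 2 \<theta>" "map_germ 3 3 \<psi>" "map_germ 3 3 \<tau>"
    "germ_eq 2 (\<theta> \<circ> \<phi>) id" "germ_eq 3 (\<tau> \<circ> \<psi>) id"
    "\<forall>\<^sub>F v in nb 2. \<psi> (C3 v) = A (\<phi> v)" "\<forall>\<^sub>F v in nb 2. C3 (\<theta> v) = \<tau> (A v)"
proof -
  obtain \<phi> \<psi> where "diffeo_germ 2 \<phi>" "diffeo_germ 3 \<psi>" and eq: "germ_eq 2 (\<psi> \<circ> C3) (A \<circ> \<phi>)"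
    using assms by (auto simp: A_equivalent_def)
  then obtain \<theta> \<tau> where g: "map_germ 2 2 \<phi>" "map_germ 2 2 \<theta>" "map_germ 3 3 \<psi>" "map_germ 3 3 \<tau>"
    and inv: "germ_eq 2 (\<theta> \<circ> \<phi>) id" "germ_eq 2 (\<phi> \<circ> \<theta>) id" "germ_eq 3 (\<tau> \<circ> \<psi>) id"
    by (auto simp: diffeo_germ_def)
  have E1: "\<forall>\<^sub>F v in nb 2. \<psi> (C3 v) = A (\<phi> v)"
    using germ_eq_eventually[OF eq] by simp
  note \<theta> = map_germ_filterlim[OF g(2)]
  have "\<forall>\<^sub>F v in nb 2. \<psi> (C3 (\<theta> v)) = A (\<phi> (\<theta> v))"
    using eventually_compose_filterlim[OF E1 \<theta>] .
  moreover have "\<forall>\<^sub>F v in nb 2. (\<tau> \<circ> \<psi>) (C3 (\<theta> v)) = id (C3 (\<theta> v))"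
    using eventually_compose_filterlim[OF germ_eq_eventually[OF inv(3)] filterlim_compose[OF filterlim_C3 \<theta>]] .
  ultimately have "\<forall>\<^sub>F v in nb 2. C3 (\<theta> v) = \<tau> (A v)"
    using germ_eq_eventually[OF inv(2)] by eventually_elim simp
  with that g inv E1 show ?thesis by blast
qed

text \<open>
  The kernel of the differential of \<^const>\<open>C3\<close> at the origin is the second axis, so \<open>\<psi>\<close> composed with
  \<^const>\<open>C3\<close> is stationary along it.
\<close>

lemma DERIV_C3_axis:
  fixes \<psi> :: "'k vec \<Rightarrow> 'k vec"
  assumes "map_germ 3 3 \<psi>" "j < 3"
  shows "((\<lambda>t. \<psi> (C3 (orig(1 := t))) j) has_field_derivative 0) (at 0)"
proof -
  have "((\<lambda>t. \<psi> (C3 (orig(1 := t))) j) has_field_derivative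
      (\<Sum>i<3. partial i (\<lambda>v. \<psi> v j) orig * (\<lambda>_. 0) i)) (at 0)"
    unfolding C3_axis
  proof (rule DERIV_chain_orig)
    show "smooth_near 3 (\<lambda>v. \<psi> v j)"
      using smooth_germ_near(2) assms by (auto simp: map_germ_def)
    show "((\<lambda>t. (orig(1 := t\<^sup>2)) i) has_field_derivative 0) (at (0::'k))" for i
      by (cases "i = 1") (auto intro!: derivative_eq_intros)
  qed (auto simp: Kn_def)
  then show ?thesis by simp
qed

text \<open>The last two components of the augmentation are the source coordinates, so
  \<open>\<phi>\<close> is stationary along the kernel axis of \<open>C3\<close>. A column of its
  Jacobian then vanishes, although \<open>\<phi>\<close> is invertible.\<close>

lemma C3_not_equivalent_augmentation_0_1:
  assumes "A_equivalent 2 3 (C3 :: 'k vec \<Rightarrow> 'k vec) (augmentation 0 1 F g)"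
  shows False
proof -
  define A where "A = augmentation 0 1 F g"
  obtain \<phi> \<theta> \<psi> \<tau> where \<phi>: "map_germ 2 2 \<phi>" and \<theta>: "map_germ 2 2 \<theta>" and \<psi>: "map_germ 3 3 \<psi>"
    and inv: "germ_eq 2 (\<theta> \<circ> \<phi>) id" and eq: "\<forall>\<^sub>F v in nb 2. \<psi> (C3 v) = A (\<phi> v)"
    unfolding A_def by (rule A_equivalent_C3E[OF assms]) blast
  have A: "A v (Suc j) = v j" for v j
    by (simp add: A_def augmentation_def pair_def sndv_def)
  have "partial 1 (\<lambda>v. \<phi> v j) orig = 0" if j: "j < 2" for j
  proof (rule DERIV_eventually_unique)
    show "((\<lambda>t. \<phi> (orig(1 := t)) j) has_field_derivative partial 1 (\<lambda>v. \<phi> v j) orig) (at 0)"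
      using smooth_germ_near(2) \<phi> j by (intro DERIV_axis) (auto simp: map_germ_def)
    show "((\<lambda>t. \<psi> (C3 (orig(1 := t))) (Suc j)) has_field_derivative 0) (at 0)"
      using j by (intro DERIV_C3_axis[OF \<psi>]) simp
    have "\<forall>\<^sub>F t in nhds 0. \<psi> (C3 (orig(1 := t))) = A (\<phi> (orig(1 := t)))"
      by (rule eventually_compose_filterlim[OF eq filterlim_axis]) simp
    then show "\<forall>\<^sub>F t in nhds 0. \<phi> (orig(1 := t)) j = \<psi> (C3 (orig(1 := t))) (Suc j)"
      by eventually_elim (simp add: A)
  qed
  with inverse_germ_partials[OF \<theta> \<phi> inv, of 1 1] show False
    by (simp add: sum_lessThan_2 del: One_nat_def)
qed

text \<open>The function u of the outline is the component of \<open>\<tau>\<close> with index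
  2.\<close>

lemma C3_not_equivalent_augmentation_1_2:
  fixes F g :: "'k vec \<Rightarrow> 'k vec"
  assumes opsu: "OPSU 1 2 f F" and g: "map_germ 1 1 g"
    and equiv: "A_equivalent 2 3 (C3 :: 'k vec \<Rightarrow> 'k vec) (augmentation 1 2 F g)"
  shows False
proof -
  obtain \<phi> \<theta> \<psi> \<tau> where \<phi>: "map_germ 2 2 \<phi>" and \<theta>: "map_germ 2 2 \<theta>"
    and \<psi>: "map_germ 3 3 \<psi>" and \<tau>: "map_germ 3 3 \<tau>"
    and inv: "germ_eq 2 (\<theta> \<circ> \<phi>) id" "germ_eq 3 (\<tau> \<circ> \<psi>) id"
    and eq1: "\<forall>\<^sub>F v in nb 2. \<psi> (C3 v) = augmentation 1 2 F g (\<phi> v)"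
    and eq2: "\<forall>\<^sub>F v in nb 2. C3 (\<theta> v) = \<tau> (augmentation 1 2 F g v)"
    by (rule A_equivalent_C3E[OF equiv]) blast
  have dims: "(1::nat) + 1 = 2" "(2::nat) + 1 = 3" by simp_all
  have stable: "stable_germ 2 3 F" and
    form: "germ_eq 2 F (\<lambda>v. pair 2 (slice 1 2 F (sndv 1 v) (fstv 1 v)) (sndv 1 v))"
    using opsu[unfolded OPSU_def dims] by auto
  have last: "\<forall>\<^sub>F v in nb 2. F v 2 = v 1"
    using germ_eq_eventually[OF form]
    by eventually_elim (metis add.right_neutral diff_self_eq_0 less_irrefl pair_def sndv_def)
  have F: "smooth_germ 2 3 F" "F orig = orig"
    using stable by (auto simp: stable_germ_def map_germ_def)
  have smF: "smooth_near 2 (\<lambda>v. F v j)" if "j < 2" for j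
    using smooth_germ_near(2)[OF F(1)] that by simp
  have sm\<theta>: "smooth_near 2 (\<lambda>v. \<theta> v j)" and sm\<phi>: "smooth_near 2 (\<lambda>v. \<phi> v j)" if "j < 2" for j
    using smooth_germ_near(2) \<theta> \<phi> that by (auto simp: map_germ_def)
  have smu: "smooth_near 3 (\<lambda>v. \<tau> v 2)"
    using smooth_germ_near(2) \<tau> by (auto simp: map_germ_def)

  define G where "G z = g (orig(0 := z)) 0" for z
  define g1 where "g1 = partial 0 (\<lambda>v. g v 0) orig"
  have G: "G 0 = 0" "(G has_field_derivative g1) (at 0)"
    using g smooth_germ_near(2)[of 1 1 g] DERIV_axis[of 1 "\<lambda>v. g v 0" 0]
    by (auto simp: G_def[abs_def] g1_def map_germ_def fun_upd_idem)
  \<comment> \<open>\<open>W\<close> is the substitution (y, z) -> (y, g(z)) in the source of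
    \<open>F\<close>. The map \<open>A\<close> built from it agrees with the augmentation near the
    origin and has values in \<open>Kn 3\<close> everywhere.\<close>
  define W where "W v = orig(0 := v 0, 1 := G (v 1))" for v :: "'k vec"
  define A where "A v = orig(0 := F (W v) 0, 1 := F (W v) 1, 2 := v 1)" for v :: "'k vec"
  have AKn: "A v \<in> Kn 3" for v by (auto simp: A_def Kn_def)
  have A: "\<forall>\<^sub>F v in nb 2. augmentation 1 2 F g v = A v"
  proof -
    have "filterlim (\<lambda>v::'k vec. orig(0 := v 1)) (nb 1) (nb 2)"
      using filterlim_ident[of "nb 2 :: 'k vec filter"] by (simp add: filterlim_nb_iff Kn_def)
    from eventually_compose_filterlim[OF smooth_germ_near(1)[of 1 1 g] this] g
    have "\<forall>\<^sub>F v::'k vec in nb 2. g (orig(0 := v 1)) \<in> Kn 1"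
      by (simp add: map_germ_def)
    then show ?thesis using eventually_nb_Kn
    proof eventually_elim
      case (elim v)
      have s: "sndv 1 v = orig(0 := v 1)" using elim(2) by (auto simp: sndv_def Kn_def fun_eq_iff)
      have p: "pair 1 (fstv 1 v) (g (orig(0 := v 1))) = W v"
        using elim(1) by (auto simp: pair_def fstv_def W_def G_def Kn_def fun_eq_iff)
      show ?case
        unfolding augmentation_def slice_def s p
        by (auto simp: pair_def fstv_def A_def fun_eq_iff)
    qed
  qed
  have eq1: "\<forall>\<^sub>F v in nb 2. \<psi> (C3 v) = A (\<phi> v)"
    using eq1 eventually_compose_filterlim[OF A map_germ_filterlim[OF \<phi>]]
    by eventually_elim simp
  have eq2: "\<forall>\<^sub>F v in nb 2. C3 (\<theta> v) = \<tau> (A v)"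
    using eq2 A by eventually_elim simp

  \<comment> \<open>The first index is the variable, the second the component. The numbers q and p
    of the outline are \<open>\<theta>' 0 1\<close> and \<open>\<theta>' 1 0\<close>.\<close>
  define \<phi>' where "\<phi>' i j = partial i (\<lambda>v. \<phi> v j) orig" for i j
  define \<theta>' where "\<theta>' i j = partial i (\<lambda>v. \<theta> v j) orig" for i j
  have D\<phi>: "((\<lambda>t. \<phi> (orig(1 := t)) j) has_field_derivative \<phi>' 1 j) (at 0)" if "j < 2" for j
    unfolding \<phi>'_def by (rule DERIV_axis[OF sm\<phi>[OF that]]) simp
  have axis1: "\<forall>\<^sub>F t in nhds 0. \<psi> (C3 (orig(1 := t))) = A (\<phi> (orig(1 := t)))"
    by (rule eventually_compose_filterlim[OF eq1 filterlim_axis]) simp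
  \<comment> \<open>The last component of \<open>A\<close> is the coordinate \<open>v 1\<close>, so
    this component of \<open>\<phi>\<close> is stationary along the kernel axis of
    \<open>C3\<close>.\<close>
  have \<phi>11: "\<phi>' 1 1 = 0"
  proof (rule DERIV_eventually_unique[OF D\<phi> DERIV_C3_axis[OF \<psi>, of 2]])
    show "\<forall>\<^sub>F t in nhds 0. \<phi> (orig(1 := t)) 1 = \<psi> (C3 (orig(1 := t))) 2"
      using axis1 by eventually_elim (simp add: A_def)
  qed simp_all
  have inv\<theta>: "\<theta>' 0 i * \<phi>' j 0 + \<theta>' 1 i * \<phi>' j 1 = (if i = j then 1 else 0)" if "i < 2" "j < 2" for i j
    using inverse_germ_partials[OF \<theta> \<phi> inv(1) that] by (simp add: sum_lessThan_2 \<theta>'_def \<phi>'_def)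
  have \<phi>10: "\<theta>' 0 1 * \<phi>' 1 0 = 1" using inv\<theta>[of 1 1] \<phi>11 by simp
  then have q: "\<theta>' 0 1 \<noteq> 0" and \<phi>10': "\<phi>' 1 0 \<noteq> 0" by auto
  have \<theta>00: "\<theta>' 0 0 = 0" using inv\<theta>[of 0 1] \<phi>11 \<phi>10' by simp
  have p: "\<theta>' 1 0 \<noteq> 0" using inv\<theta>[of 0 0] \<theta>00 by auto
  have \<phi>0: "\<phi> orig = orig" and \<theta>0: "\<theta> orig = orig" and \<tau>0: "\<tau> orig = orig"
    using \<phi> \<theta> \<tau> by (auto simp: map_germ_def)

  \<comment> \<open>Also the first two components of \<open>A \<circ> \<phi>\<close> are stationary
    on that axis. As \<open>\<phi>' 1 1 = 0\<close>, the chain rule leaves only the derivative of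
    \<open>F\<close> in y, times the nonzero \<open>\<phi>' 1 0\<close>.\<close>
  have crit: "partial 0 (\<lambda>v. F v j) orig = 0" if j: "j < 2" for j
  proof -
    have "(\<Sum>i<2. partial i (\<lambda>v. F v j) orig * (if i = 0 then \<phi>' 1 0 else g1 * \<phi>' 1 1)) = 0"
    proof (rule DERIV_eventually_unique[OF DERIV_chain_orig
        [where \<gamma> = "\<lambda>t. W (\<phi> (orig(1 := t)))", OF smF[OF j]] DERIV_C3_axis[OF \<psi>, of j]])
      show "W (\<phi> (orig(1 := 0))) = orig" using \<phi>0 G(1) by (auto simp: W_def fun_upd_idem)
      show "\<forall>\<^sub>F t in nhds 0. W (\<phi> (orig(1 := t))) \<in> Kn 2" by (auto simp: W_def Kn_def)
      show "((\<lambda>t. W (\<phi> (orig(1 := t))) i) has_field_derivative (if i = 0 then \<phi>' 1 0 else g1 * \<phi>' 1 1)) (at 0)"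
        if "i < 2" for i
      proof (cases "i = 0")
        case True
        then show ?thesis using D\<phi>[of 0] by (simp add: W_def)
      next
        case False
        then have "i = 1" using that by simp
        moreover have "(G has_field_derivative g1) (at (\<phi> (orig(1 := 0)) 1))"
          using G(2) \<phi>0 by (simp add: fun_upd_idem)
        ultimately show ?thesis using DERIV_chain2[OF _ D\<phi>[of 1]] by (simp add: W_def)
      qed
      show "\<forall>\<^sub>F t in nhds 0. F (W (\<phi> (orig(1 := t)))) j = \<psi> (C3 (orig(1 := t))) j"
        using axis1
      proof eventually_elim
        case (elim t)
        then show ?case using j by (cases "j = 0") (auto simp: A_def less_2_cases_iff)
      qed
    qed (use j in auto)
    then show ?thesis using \<phi>11 \<phi>10' by (simp add: sum_lessThan_2)
  qed

  define e :: "'k \<Rightarrow> 'k vec" where "e t = orig(0 := t)" for t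
  have ax: "\<forall>\<^sub>F t in at 0. P (e t)" if "eventually P (nb 2)" for P
    unfolding e_def by (rule eventually_axis[OF that]) simp
  define h :: "'k \<Rightarrow> 'k vec" where "h t = A (e t)" for t
  have We: "W (e t) = e t" for t by (auto simp: W_def e_def G(1))
  have h: "h t = orig(0 := F (e t) 0, 1 := F (e t) 1, 2 := 0)" for t
    by (simp add: h_def A_def We) (simp add: e_def)
  have hKn: "h t \<in> Kn 3" for t unfolding h_def by (rule AKn)
  define a where "a j = partial 0 (partial 0 (\<lambda>v. F v j)) orig / 2" for j
  define b where "b j = partial 0 (partial 0 (partial 0 (\<lambda>v. F v j))) orig / 6" for j
  define k where "k j = partial 0 (partial 1 (\<lambda>v. F v j)) orig" for j
  define \<alpha> where "\<alpha> i = partial i (\<lambda>v. \<tau> v 2) orig" for i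
  define B where "B i = partial i (partial 2 (\<lambda>v. \<tau> v 2)) orig" for i
  have jF: "jet4 (\<lambda>t. F (e t) j) 0 0 (a j) (b j)" if "j < 2" for j
    using jet4_axis[OF smF[OF that], of 0] F(2) crit[OF that] by (simp add: e_def a_def b_def)
  have jK: "\<exists>k0 k2 k3. jet4 (\<lambda>t. partial 1 (\<lambda>v. F v j) (e t)) k0 (k j) k2 k3" if "j < 2" for j
    using jet4_axis[OF smooth_near_partial[OF smF[OF that]], of 1 0] by (auto simp: e_def k_def)
  have jh: "jet4 (\<lambda>t. h t j) 0 0 (if j < 2 then a j else 0) (if j < 2 then b j else 0)" if j: "j < 3" for j
  proof -
    consider "j = 0" | "j = 1" | "j = 2" using j by linarith
    then show ?thesis
      using jF[of 0] jF[of 1] by cases (auto simp: h jet4_def)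
  qed
  have ju: "jet4 (\<lambda>t. f (h t)) (f orig) 0 (partial 0 f orig * a 0 + partial 1 f orig * a 1)
      (partial 0 f orig * b 0 + partial 1 f orig * b 1)" if "smooth_near 3 f" for f
    using jet4_compose[OF that hKn jh] by (simp add: sum_lessThan_3)
  obtain x2 x3 where x: "jet4 (\<lambda>t. \<theta> (e t) 0) 0 0 x2 x3"
    using jet4_axis[OF sm\<theta>[of 0], of 0] \<theta>0 \<theta>00 by (auto simp: e_def \<theta>'_def)
  obtain y2 y3 where y: "jet4 (\<lambda>t. \<theta> (e t) 1) 0 (\<theta>' 0 1) y2 y3"
    using jet4_axis[OF sm\<theta>[of 1], of 0] \<theta>0 by (auto simp: e_def \<theta>'_def)
  obtain x1' x2' x3' where x': "jet4 (\<lambda>t. partial 1 (\<lambda>v. \<theta> v 0) (e t)) (\<theta>' 1 0) x1' x2' x3'"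
    using jet4_axis[OF smooth_near_partial[OF sm\<theta>[of 0]], of 1 0] by (auto simp: e_def \<theta>'_def)
  obtain y0' y1' y2' y3' where y': "jet4 (\<lambda>t. partial 1 (\<lambda>v. \<theta> v 1) (e t)) y0' y1' y2' y3'"
    using jet4_axis[OF smooth_near_partial[OF sm\<theta>[of 1]], of 1 0] by (auto simp: e_def)
  have yy: "jet4 (\<lambda>t. \<theta> (e t) 1 * \<theta> (e t) 1) 0 0 (\<theta>' 0 1 * \<theta>' 0 1) (\<theta>' 0 1 * y2 + y2 * \<theta>' 0 1)"
    using jet4_mult[OF y y] by simp
  have yyy: "jet4 (\<lambda>t. \<theta> (e t) 1 * (\<theta> (e t) 1 * \<theta> (e t) 1)) 0 0 0 (\<theta>' 0 1 * (\<theta>' 0 1 * \<theta>' 0 1))"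
    using jet4_mult[OF y yy] by simp
  have xx: "jet4 (\<lambda>t. \<theta> (e t) 0 * \<theta> (e t) 0) 0 0 0 0"
    using jet4_mult[OF x x] by simp

  \<comment> \<open>On the axis z = 0 the factors \<open>\<theta> (e t) 0\<close> and
    \<open>\<theta> (e t) 1\<close> are O(t^2) and O(t), so the right-hand side has zero
    3-jet.\<close>
  have "\<forall>\<^sub>F t in at 0. \<tau> (h t) 2 = \<theta> (e t) 0 * (\<theta> (e t) 1 * (\<theta> (e t) 1 * \<theta> (e t) 1)) +
      \<theta> (e t) 0 * (\<theta> (e t) 0 * \<theta> (e t) 0) * \<theta> (e t) 1"
    using ax[OF eq2]
  proof eventually_elim
    case (elim t)
    from fun_cong[OF elim, of 2]
    have "\<tau> (h t) 2 = \<theta> (e t) 0 * \<theta> (e t) 1 ^ 3 + \<theta> (e t) 0 ^ 3 * \<theta> (e t) 1"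
      by (simp add: C3_def Let_def h_def)
    then show ?case by (simp add: power3_eq_cube mult.assoc)
  qed
  from jet4_unique[OF ju[OF smu] jet4_add[OF jet4_mult[OF x yyy] jet4_mult[OF jet4_mult[OF x xx] y]] this]
  have \<alpha>a: "\<alpha> 0 * a 0 + \<alpha> 1 * a 1 = 0" and \<alpha>b: "\<alpha> 0 * b 0 + \<alpha> 1 * b 1 = 0"
    unfolding \<alpha>_def by simp_all

  have lim_e: "filterlim e (nb 2) (at 0)"
    unfolding e_def by (rule filterlim_mono[OF filterlim_axis order_refl at_within_le_nhds]) simp
  have lim_h: "filterlim h (nb 3) (at 0)"
  proof -
    have "((\<lambda>t. F (e t) j) \<longlongrightarrow> 0) (at 0)" if "j < 2" for j
      using smooth_near_tendsto[OF smF[OF that] lim_e] F(2) by simp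
    then have "((\<lambda>t. h t j) \<longlongrightarrow> 0) (at 0)" for j
      by (cases "j = 0"; cases "j = 1"; cases "j = 2") (simp_all add: h)
    then show ?thesis using hKn by (simp add: filterlim_nb_iff)
  qed
  define u' where "u' i t = partial i (\<lambda>v. \<tau> v 2) (h t)" for i t
  define F' where "F' j t = partial 1 (\<lambda>v. F v j) (e t)" for j t
  define \<Theta> where "\<Theta> j t = \<theta> (e t) j" for j t
  define \<Theta>' where "\<Theta>' j t = partial 1 (\<lambda>v. \<theta> v j) (e t)" for j t
  have dF: "\<forall>\<^sub>F t in at 0. ((\<lambda>s. F ((e t)(1 := s)) j) has_field_derivative F' j t) (at 0)" if "j < 2" for j
    using ax[OF smooth_near_DERIV[OF smF[OF that], of 1]] by (simp add: e_def F'_def)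
  have d\<theta>: "\<forall>\<^sub>F t in at 0. ((\<lambda>s. \<theta> ((e t)(1 := s)) j) has_field_derivative \<Theta>' j t) (at 0)" if "j < 2" for j
    using ax[OF smooth_near_DERIV[OF sm\<theta>[OF that], of 1]] by (simp add: e_def \<Theta>'_def)
  \<comment> \<open>The z-derivative, at each point of the axis z = 0 near the origin, of the third
    component of \<open>C3 \<circ> \<theta> = \<tau> \<circ> A\<close>. Products are grouped as in
    the jets already computed.\<close>
  have normal: "\<forall>\<^sub>F t in at 0. g1 * (u' 0 t * F' 0 t + u' 1 t * F' 1 t) + u' 2 t =
      \<Theta>' 0 t * (\<Theta> 1 t * (\<Theta> 1 t * \<Theta> 1 t)) + (\<Theta> 0 t * (3 * ((\<Theta> 1 t * \<Theta> 1 t) * \<Theta>' 1 t)) +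
        (3 * ((\<Theta> 0 t * \<Theta> 0 t) * \<Theta>' 0 t) * \<Theta> 1 t + \<Theta> 0 t * (\<Theta> 0 t * \<Theta> 0 t) * \<Theta>' 1 t))"
    using eventually_compose_filterlim[OF smooth_near_chain[OF smu] lim_h]
      dF[of 0, simplified] dF[of 1, simplified] d\<theta>[of 0, simplified] d\<theta>[of 1, simplified] ax[OF eventually_nb_eventually[OF eq2]]
  proof eventually_elim
    case (elim t)
    have et: "(e t)(1 := 0) = e t" "(e t) 1 = 0" by (auto simp: e_def)
    have dFG: "((\<lambda>s. F ((e t)(1 := G s)) j) has_field_derivative F' j t * g1) (at 0)" if "j < 2" for j
    proof (rule DERIV_chain2[OF _ G(2)])
      show "((\<lambda>s. F ((e t)(1 := s)) j) has_field_derivative F' j t) (at (G 0))"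
        using elim(2,3) that by (auto simp: G(1) less_2_cases_iff)
    qed
    have "((\<lambda>s. \<tau> (A ((e t)(1 := s))) 2) has_field_derivative
        (\<Sum>i<3. partial i (\<lambda>v. \<tau> v 2) (h t) * (if i < 2 then F' i t * g1 else 1))) (at 0)"
    proof (rule elim(1)[rule_format])
      show "A ((e t)(1 := 0)) = h t" by (simp only: et h_def)
      show "\<forall>\<^sub>F s in nhds 0. A ((e t)(1 := s)) \<in> Kn 3" using AKn by simp
      fix i :: nat assume "i < 3"
      then consider "i = 0" | "i = 1" | "i = 2" by linarith
      moreover have "W ((e t)(1 := s)) = (e t)(1 := G s)" for s
        by (auto simp: W_def e_def fun_eq_iff)
      ultimately show "((\<lambda>s. A ((e t)(1 := s)) i) has_field_derivative
          (if i < 2 then F' i t * g1 else 1)) (at 0)"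
        using dFG[of 0] dFG[of 1] by cases (simp_all add: A_def)
    qed
    moreover have "((\<lambda>s. \<theta> ((e t)(1 := s)) 0 * \<theta> ((e t)(1 := s)) 1 ^ 3 +
          \<theta> ((e t)(1 := s)) 0 ^ 3 * \<theta> ((e t)(1 := s)) 1) has_field_derivative
        \<Theta>' 0 t * (\<Theta> 1 t * (\<Theta> 1 t * \<Theta> 1 t)) + (\<Theta> 0 t * (3 * ((\<Theta> 1 t * \<Theta> 1 t) * \<Theta>' 1 t)) +
        (3 * ((\<Theta> 0 t * \<Theta> 0 t) * \<Theta>' 0 t) * \<Theta> 1 t + \<Theta> 0 t * (\<Theta> 0 t * \<Theta> 0 t) * \<Theta>' 1 t))) (at 0)"
    proof -
      have th: "\<theta> ((e t)(1 := 0)) j = \<Theta> j t" for j by (simp only: et \<Theta>_def)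
      show ?thesis
        by (rule DERIV_cong[OF DERIV_add[OF DERIV_mult[OF elim(4)[folded One_nat_def] DERIV_power[OF elim(5)[folded One_nat_def], of 3]]
              DERIV_mult[OF DERIV_power[OF elim(4)[folded One_nat_def], of 3] elim(5)[folded One_nat_def]]]])
           (unfold th, simp add: algebra_simps power2_eq_square power3_eq_cube)
    qed
    moreover have "\<forall>\<^sub>F s in nhds 0. \<tau> (A ((e t)(1 := s))) 2 = \<theta> ((e t)(1 := s)) 0 * \<theta> ((e t)(1 := s)) 1 ^ 3 +
          \<theta> ((e t)(1 := s)) 0 ^ 3 * \<theta> ((e t)(1 := s)) 1"
    proof -
      have "\<forall>\<^sub>F s in nhds ((e t) 1). C3 (\<theta> ((e t)(1 := s))) = \<tau> (A ((e t)(1 := s)))"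
        using elim(6) by (elim allE[of _ 1]) simp
      then show ?thesis
        unfolding et(2)
      proof eventually_elim
        case (elim s)
        from fun_cong[OF elim, of 2] show ?case by (simp add: C3_def Let_def)
      qed
    qed
    ultimately have "(\<Sum>i<3. partial i (\<lambda>v. \<tau> v 2) (h t) * (if i < 2 then F' i t * g1 else 1)) =
      \<Theta>' 0 t * (\<Theta> 1 t * (\<Theta> 1 t * \<Theta> 1 t)) + (\<Theta> 0 t * (3 * ((\<Theta> 1 t * \<Theta> 1 t) * \<Theta>' 1 t)) +
        (3 * ((\<Theta> 0 t * \<Theta> 0 t) * \<Theta>' 0 t) * \<Theta> 1 t + \<Theta> 0 t * (\<Theta> 0 t * \<Theta> 0 t) * \<Theta>' 1 t))"
      by (rule DERIV_eventually_unique)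
    moreover have "(\<Sum>i<3. partial i (\<lambda>v. \<tau> v 2) (h t) * (if i < 2 then F' i t * g1 else 1)) =
        g1 * (u' 0 t * F' 0 t + u' 1 t * F' 1 t) + u' 2 t"
      by (simp add: sum_lessThan_3 u'_def algebra_simps)
    ultimately show ?case by simp
  qed
  obtain k00 k02 k03 k10 k12 k13 where jF':
    "jet4 (F' 0) k00 (k 0) k02 k03" "jet4 (F' 1) k10 (k 1) k12 k13"
    using jK[of 0] jK[of 1] unfolding F'_def by auto
  \<comment> \<open>The linear coefficients vanish because \<open>h\<close> is O(t^2); hence the
    coefficient of \<open>t\<close> in \<open>L\<close> involves only \<open>g1\<close>,
    \<open>\<alpha>\<close> and \<open>k\<close>.\<close>
  obtain u02 u03 u12 u13 where ju': "jet4 (u' 0) (\<alpha> 0) 0 u02 u03" "jet4 (u' 1) (\<alpha> 1) 0 u12 u13"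
    using ju[OF smooth_near_partial[OF smu], of 0] ju[OF smooth_near_partial[OF smu], of 1]
    unfolding u'_def \<alpha>_def by auto
  have ju2: "jet4 (u' 2) (\<alpha> 2) 0 (B 0 * a 0 + B 1 * a 1) (B 0 * b 0 + B 1 * b 1)"
    using ju[OF smooth_near_partial[OF smu], of 2] unfolding u'_def \<alpha>_def B_def by simp
  have L: "jet4 (\<lambda>t. g1 * (u' 0 t * F' 0 t + u' 1 t * F' 1 t) + u' 2 t)
      (g1 * (\<alpha> 0 * k00 + \<alpha> 1 * k10) + \<alpha> 2) (g1 * (\<alpha> 0 * k 0 + \<alpha> 1 * k 1))
      (g1 * (\<alpha> 0 * k02 + u02 * k00 + (\<alpha> 1 * k12 + u12 * k10)) + (B 0 * a 0 + B 1 * a 1))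
      (g1 * (\<alpha> 0 * k03 + u02 * k 0 + u03 * k00 + (\<alpha> 1 * k13 + u12 * k 1 + u13 * k10)) + (B 0 * b 0 + B 1 * b 1))"
    using jet4_add[OF jet4_cmult[OF jet4_add[OF jet4_mult[OF ju'(1) jF'(1)] jet4_mult[OF ju'(2) jF'(2)]]] ju2]
    by simp
  note x = x[folded \<Theta>_def] and y = y[folded \<Theta>_def] and x' = x'[folded \<Theta>'_def] and y' = y'[folded \<Theta>'_def]
    and yy = yy[folded \<Theta>_def] and yyy = yyy[folded \<Theta>_def] and xx = xx[folded \<Theta>_def]
  \<comment> \<open>Only the constant term of \<open>\<Theta>' 0\<close> times the cube of the
    linear term of \<open>\<Theta> 1\<close> survives; all other summands are O(t^4).\<close>
  have "jet4 (\<lambda>t. \<Theta>' 0 t * (\<Theta> 1 t * (\<Theta> 1 t * \<Theta> 1 t)) + (\<Theta> 0 t * (3 * ((\<Theta> 1 t * \<Theta> 1 t) * \<Theta>' 1 t)) +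
        (3 * ((\<Theta> 0 t * \<Theta> 0 t) * \<Theta>' 0 t) * \<Theta> 1 t + \<Theta> 0 t * (\<Theta> 0 t * \<Theta> 0 t) * \<Theta>' 1 t)))
      0 0 0 (\<theta>' 1 0 * (\<theta>' 0 1 * (\<theta>' 0 1 * \<theta>' 0 1)))"
    using jet4_add[OF jet4_mult[OF x' yyy] jet4_add[OF jet4_mult[OF x jet4_cmult[OF jet4_mult[OF yy y'], of 3]]
      jet4_add[OF jet4_mult[OF jet4_cmult[OF jet4_mult[OF xx x'], of 3] y] jet4_mult[OF jet4_mult[OF x xx] y']]]]
    by simp
  note eqs = jet4_unique[OF L this normal]
  \<comment> \<open>Otherwise the constant coefficients give \<open>\<alpha> 2 = 0\<close> too, and
    a row of the Jacobian of the invertible \<open>\<tau>\<close> vanishes.\<close>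
  have \<alpha>: "\<alpha> 0 \<noteq> 0 \<or> \<alpha> 1 \<noteq> 0"
  proof (rule ccontr)
    assume *: "\<not> (\<alpha> 0 \<noteq> 0 \<or> \<alpha> 1 \<noteq> 0)"
    with eqs(1) have "\<alpha> 2 = 0" by simp
    with * inverse_germ_partials[OF \<tau> \<psi> inv(2), of 2 2] show False
      by (simp add: sum_lessThan_3 flip: \<alpha>_def)
  qed
  note nondeg = stable_unfolding_coefficients[OF stable last crit a_def b_def k_def \<alpha> \<alpha>a \<alpha>b]
  from eqs(2) nondeg(1) have "g1 = 0" by simp
  with eqs(3,4) have Ba: "B 0 * a 0 + B 1 * a 1 = 0"
    and Bb: "B 0 * b 0 + B 1 * b 1 = \<theta>' 1 0 * (\<theta>' 0 1 * (\<theta>' 0 1 * \<theta>' 0 1))" by simp_all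
  \<comment> \<open>A nonzero \<open>\<alpha>\<close> orthogonal to both \<open>a\<close> and
    \<open>b\<close> makes them linearly dependent, so with \<open>a\<close> nonzero the
    orthogonality of \<open>B\<close> to \<open>a\<close> passes to \<open>b\<close>.\<close>
  have "\<alpha> 0 * (a 0 * b 1 - a 1 * b 0) = 0" "\<alpha> 1 * (a 0 * b 1 - a 1 * b 0) = 0"
    using \<alpha>a \<alpha>b by algebra+
  with \<alpha> have "a 0 * b 1 - a 1 * b 0 = 0" by auto
  then have "a 0 * (B 0 * b 0 + B 1 * b 1) = 0" "a 1 * (B 0 * b 0 + B 1 * b 1) = 0"
    using Ba by algebra+
  with nondeg(2) have "B 0 * b 0 + B 1 * b 1 = 0" by auto
  with Bb p q show False by simp
qed

lemma C3_not_augmentation: "\<not> is_augmentation 2 3 (C3 :: 'k vec \<Rightarrow> 'k vec)"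
proof
  assume "is_augmentation 2 3 (C3 :: 'k vec \<Rightarrow> 'k vec)"
  then obtain n p d and f F g :: "'k vec \<Rightarrow> 'k vec" where *: "2 = n + d" "3 = p + d" "d \<ge> 1"
    "OPSU n p f F" "map_germ d 1 g" "A_equivalent 2 3 C3 (augmentation n p F g)"
    unfolding is_augmentation_def by blast
  then consider "n = 0" "p = 1" | "n = 1" "p = 2" "d = 1" by linarith
  then show False
  proof cases
    case 1
    with * show ?thesis using C3_not_equivalent_augmentation_0_1 by blast
  next
    case 2
    with * show ?thesis using C3_not_equivalent_augmentation_1_2 by blast
  qed
qed

end

theorem proposition4p2:
  shows "\<not> is_augmentation 2 3 (C3 :: real vec \<Rightarrow> real vec) \<and>
         \<not> is_augmentation 2 3 (C3 :: complex vec \<Rightarrow> complex vec)"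
  using real.C3_not_augmentation complex.C3_not_augmentation by blast

end
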